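(* Set $t=q$. For all $u,v\in S_n$, $$r_{u,v}=\phi_{v^{-1}}^{-1}\;Z^\square_{1_W,u^{-1}}|_{v^{-1}} .$$ Moreover $Z^\square_{1_W,u^{-1}}|_{v^{-1}}$ is the partition function of the lattice model whose Boltzmann weights at the vertex in row $i$ and column $j$ are obtained from the K-theoretic weights (listed in the context) by putting $t=q$ and replacing $xy^{-1}$ by $\boldsymbol{y}^\alpha$ with $\alpha=e_{v^{-1}(i)}-e_j$.
   Context: $W=S_n$, $1_W$ the identity, $s_i=(i,i+1)$, $\leqslant$ Bruhat order, products are compositions; $\Phi^+=\{e_i-e_j:i<j\}$, $\Phi^-=-\Phi^+$, $\alpha_i=e_i-e_{i+1}$, $w(e_i)=e_{w(i)}$, $\boldsymbol{y}^{e_i-e_j}=y_i/y_j$; $q$ is an indeterminate. For $f(\boldsymbol{x};\boldsymbol{y})$, $f|_v=f(y_{v(1)},\dots,y_{v(n)};y_1,\dots,y_n)$. $r_{u,v}(\boldsymbol{y})$, $u,v\in S_n$, are the Bump–Nakasuji deformations of Kazhdan–Lusztig $R$-polynomials: the unique rational functions (known to exist) with $r_{u,v}=0$ unless $u\leqslant v$, $r_{v,v}=1$, and, for every $s=s_i$ with $s_iv<v$, with $\beta=-v^{-1}(\alpha_i)\in\Phi^+$: $r_{u,v}=\frac{1-q}{1-\boldsymbol{y}^\beta}r_{u,sv}+r_{su,sv}$ if $su<u$, and $r_{u,v}=(1-q)\frac{\boldsymbol{y}^\beta}{1-\boldsymbol{y}^\beta}r_{u,sv}+q\,r_{su,sv}$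 if $su>u$. For $w\in S_n$, $$\phi_w(\boldsymbol{y})=\prod_{\substack{\alpha\in\Phi^+\\ w^{-1}(\alpha)\in\Phi^+}}(q\boldsymbol{y}^{-\alpha}-1)\prod_{\substack{\alpha\in\Phi^+\\ w^{-1}(\alpha)\in\Phi^-}}(1-\boldsymbol{y}^{-\alpha}).$$ Lattice model ($\square=(n,n-1,\dots,1)$): an $n\times n$ square grid with rows numbered $1,\dots,n$ from top to bottom and columns numbered $1,\dots,n$ from right to left; the vertex in row $i$, column $j$ has parameters $x=x_i$, $y=y_j$. Horizontal edges carry a spin in $\{+,1,\dots,n\}$ ($+$ = uncolored), vertical edges carry a subset of the color set $\{1<\dots<n\}$. The (K-theoretic) weight of a vertex with left spin $L$, top spin $\Sigma$, right spin $L'$, bottom spin $\Sigma'$, written $(L,\Sigma;L',\Sigma')$, is zero unless listed ($\Sigma_{>c},\Sigma_{<c},\Sigma_{(c,d)}$ denote the elements of $\Sigma$ that are $>c$, $<c$, strictly between $c$ and $d$): (1) $(+,\Sigma;+,\Sigma)$: $(-t)^{|\Sigma|}$. (2) $(c,\Sigma;c,\Sigma)$: $t^{|\Sigma_{>c}|}(-xy^{-1}+t^{\delta})$ with $\delta=1$ if $c\in\Sigma$, else $0$. (3) $(+,\Sigma;c,\Sigma\setminus\{c\})$, $c\in\Sigma$: $(-t)^{|\Sigma_{<c}|}t^{|\Sigma_{>c}|}$. (4) $(c,\Sigma;+,\Sigma\cup\{c\})$, $c\notin\Sigma$: $-(1-t)xy^{-1}(-t)^{|\Sigma_{>c}|}$.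 (5) $(c,\Sigma;d,(\Sigma\cup\{c\})\setminus\{d\})$, $c<d$, $d\in\Sigma$, $c\notin\Sigma$: $-(1-t)xy^{-1}(-t)^{|\Sigma_{(c,d)}|}t^{|\Sigma_{>d}|}$. (6) $(d,\Sigma;c,(\Sigma\cup\{d\})\setminus\{c\})$, $c<d$, $c\in\Sigma$, $d\notin\Sigma$: $-(1-t)(-1)^{|\Sigma_{(c,d)}|}t^{|\Sigma_{>d}|}$. $Z^\square_{\sigma,w}(\boldsymbol{x};\boldsymbol{y})$ is the partition function, i.e. the sum over all assignments of spins to interior edges of the product of the vertex weights, with boundary conditions: the top boundary edge in column $j$ carries the single color $\sigma(j)$; the right boundary edge in row $i$ has color $w(i)$; left and bottom boundary edges are uncolored. *)

theory Defs
  imports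
    "HOL-Library.FuncSet"
    "HOL-Library.Poly_Mapping"
    "HOL-Combinatorics.Permutations"
    "HOL-Computational_Algebra.Fraction_Field"
begin

text \<open>
  The field of rational functions over a coefficient field \<open>'k\<close> in countably many
  indeterminates: the fraction field of the polynomial ring whose elements are finitely supported
  maps from monomials to coefficients.  Indeterminate number 0 serves as \<open>q\<close> and
  indeterminate number \<open>i \<ge> 1\<close> as \<open>y\<^sub>i\<close>; \<open>yvar\<close> is only ever meant
  to be used at indices \<open>\<ge> 1\<close>.
\<close>

type_synonym 'k ratfun = "((nat \<Rightarrow>\<^sub>0 nat) \<Rightarrow>\<^sub>0 'k) fract"

definition indet :: "nat \<Rightarrow> 'k::field ratfun"
  where "indet i = Fract (Poly_Mapping.single (Poly_Mapping.single i 1) 1) 1"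

definition qvar :: "'k::field ratfun"
  where "qvar = indet 0"

definition yvar :: "nat \<Rightarrow> 'k::field ratfun"
  where "yvar i = indet i"


section \<open>Roots, simple reflections and Bruhat order of the symmetric group\<close>

text \<open>
  Elements of \<open>S\<^sub>n\<close> are functions \<open>w\<close> with \<open>w permutes {1..n}\<close>.
  The pair \<open>(i, j)\<close> encodes the vector \<open>e\<^sub>i - e\<^sub>j\<close>.  (For \<open>i = j\<close>
  it encodes 0, and accordingly \<open>yexp\<close> is then 1 if \<open>y i \<noteq> 0\<close>.)
\<close>

definition pos_roots :: "nat \<Rightarrow> (nat \<times> nat) set"
  where "pos_roots n = {(i, j). 1 \<le> i \<and> i < j \<and> j \<le> n}"

definition neg_root :: "nat \<times> nat \<Rightarrow> nat \<times> nat"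
  where "neg_root = prod.swap"

definition neg_roots :: "nat \<Rightarrow> (nat \<times> nat) set"
  where "neg_roots n = neg_root ` pos_roots n"

definition simple_root :: "nat \<Rightarrow> nat \<times> nat"
  where "simple_root i = (i, i + 1)"

definition root_act :: "(nat \<Rightarrow> nat) \<Rightarrow> nat \<times> nat \<Rightarrow> nat \<times> nat"
  where "root_act w = map_prod w w"

definition yexp :: "(nat \<Rightarrow> 'a::field) \<Rightarrow> nat \<times> nat \<Rightarrow> 'a"
  where "yexp y \<alpha> = y (fst \<alpha>) / y (snd \<alpha>)"

definition simple_refl :: "nat \<Rightarrow> nat \<Rightarrow> nat"
  where "simple_refl i = transpose i (i + 1)"

definition perm_length :: "nat \<Rightarrow> (nat \<Rightarrow> nat) \<Rightarrow> nat"
  where "perm_length n w = card {\<alpha> \<in> pos_roots n. root_act w \<alpha> \<in> neg_roots n}"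

definition bruhat_step :: "nat \<Rightarrow> (nat \<Rightarrow> nat) \<Rightarrow> (nat \<Rightarrow> nat) \<Rightarrow> bool"
  where "bruhat_step n u v \<longleftrightarrow>
    u permutes {1..n} \<and> perm_length n u < perm_length n v \<and>
    (\<exists>i j. 1 \<le> i \<and> i < j \<and> j \<le> n \<and> v = u \<circ> transpose i j)"

definition bruhat_le :: "nat \<Rightarrow> (nat \<Rightarrow> nat) \<Rightarrow> (nat \<Rightarrow> nat) \<Rightarrow> bool"
  where "bruhat_le n = (bruhat_step n)\<^sup>*\<^sup>*"

definition bruhat_less :: "nat \<Rightarrow> (nat \<Rightarrow> nat) \<Rightarrow> (nat \<Rightarrow> nat) \<Rightarrow> bool"
  where "bruhat_less n u v \<longleftrightarrow> bruhat_le n u v \<and> u \<noteq> v"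


section \<open>Deformed R-polynomials\<close>

text \<open>
  The properties that characterise the Bump--Nakasuji family \<open>(r\<^sub>u\<^sub>,\<^sub>v)\<close>.
  Only the values at pairs of elements of \<open>S\<^sub>n\<close> are constrained.
\<close>

definition bump_nakasuji_family ::
  "nat \<Rightarrow> 'a::field \<Rightarrow> (nat \<Rightarrow> 'a) \<Rightarrow> ((nat \<Rightarrow> nat) \<Rightarrow> (nat \<Rightarrow> nat) \<Rightarrow> 'a) \<Rightarrow> bool"
  where "bump_nakasuji_family n q y r \<longleftrightarrow>
    (\<forall>u v. u permutes {1..n} \<longrightarrow> v permutes {1..n} \<longrightarrow> \<not> bruhat_le n u v \<longrightarrow> r u v = 0) \<and>
    (\<forall>v. v permutes {1..n} \<longrightarrow> r v v = 1) \<and>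
    (\<forall>u v i. u permutes {1..n} \<longrightarrow> v permutes {1..n} \<longrightarrow> 1 \<le> i \<longrightarrow> i < n \<longrightarrow>
       (let s = simple_refl i;
            \<beta> = neg_root (root_act (inv v) (simple_root i))
        in bruhat_less n (s \<circ> v) v \<longrightarrow>
          (bruhat_less n (s \<circ> u) u \<longrightarrow>
             r u v = (1 - q) / (1 - yexp y \<beta>) * r u (s \<circ> v) + r (s \<circ> u) (s \<circ> v)) \<and>
          (bruhat_less n u (s \<circ> u) \<longrightarrow>
             r u v = (1 - q) * (yexp y \<beta> / (1 - yexp y \<beta>)) * r u (s \<circ> v)
                     + q * r (s \<circ> u) (s \<circ> v))))"

definition phi :: "nat \<Rightarrow> 'a::field \<Rightarrow> (nat \<Rightarrow> 'a) \<Rightarrow> (nat \<Rightarrow> nat) \<Rightarrow> 'a"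
  where "phi n q y w =
    (\<Prod>\<alpha> \<in> {\<alpha> \<in> pos_roots n. root_act (inv w) \<alpha> \<in> pos_roots n}. q * yexp y (neg_root \<alpha>) - 1) *
    (\<Prod>\<alpha> \<in> {\<alpha> \<in> pos_roots n. root_act (inv w) \<alpha> \<in> neg_roots n}. 1 - yexp y (neg_root \<alpha>))"


section \<open>The lattice model\<close>

text \<open>
  Horizontal spins: \<open>None\<close> is the uncoloured spin \<open>+\<close>, and \<open>Some c\<close> is the
  colour \<open>c\<close>.  The arguments of a vertex weight are, in this order, the left, top, right and
  bottom spins.
\<close>

type_synonym 'a weight = "nat option \<Rightarrow> nat set \<Rightarrow> nat option \<Rightarrow> nat set \<Rightarrow> 'a"

text \<open>
  The weights depend on \<open>x\<close> and \<open>y\<close> only through \<open>z = x y\<^sup>-\<^sup>1\<close>.  The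
  last equation covers the two cases of distinct colours; if \<open>b < a\<close>, the smaller colour is
  the one on the right.
\<close>

fun weight_at :: "'a::field \<Rightarrow> 'a \<Rightarrow> 'a weight" where
  "weight_at t z None \<Sigma> None \<Sigma>' =
     (if \<Sigma>' = \<Sigma> then (- t) ^ card \<Sigma> else 0)"
| "weight_at t z None \<Sigma> (Some c) \<Sigma>' =
     (if c \<in> \<Sigma> \<and> \<Sigma>' = \<Sigma> - {c}
      then (- t) ^ card {k \<in> \<Sigma>. k < c} * t ^ card {k \<in> \<Sigma>. k > c} else 0)"
| "weight_at t z (Some c) \<Sigma> None \<Sigma>' =
     (if c \<notin> \<Sigma> \<and> \<Sigma>' = \<Sigma> \<union> {c}
      then - (1 - t) * z * (- t) ^ card {k \<in> \<Sigma>. k > c} else 0)"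
| "weight_at t z (Some a) \<Sigma> (Some b) \<Sigma>' =
     (if a = b then
        (if \<Sigma>' = \<Sigma>
         then t ^ card {k \<in> \<Sigma>. k > a} * (- z + t ^ (if a \<in> \<Sigma> then 1 else 0)) else 0)
      else if b \<in> \<Sigma> \<and> a \<notin> \<Sigma> \<and> \<Sigma>' = (\<Sigma> \<union> {a}) - {b} then
        (if a < b
         then - (1 - t) * z * (- t) ^ card {k \<in> \<Sigma>. a < k \<and> k < b} * t ^ card {k \<in> \<Sigma>. k > b}
         else - (1 - t) * (- 1) ^ card {k \<in> \<Sigma>. b < k \<and> k < a} * t ^ card {k \<in> \<Sigma>. k > a})
      else 0)"

definition K_weight :: "'a::field \<Rightarrow> 'a \<Rightarrow> 'a \<Rightarrow> 'a weight"
  where "K_weight t x y = weight_at t (x * inverse y)"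

text \<open>
  A state is a pair \<open>(h, V)\<close> of assignments of spins to the horizontal and the vertical edges.
  Since columns are numbered from right to left, \<open>h (i, j)\<close> is the spin of the edge to the left
  of the vertex in row \<open>i\<close>, column \<open>j\<close>, and \<open>h (i, j - 1)\<close> that of the edge
  to its right; in particular \<open>h (i, 0)\<close> and \<open>h (i, n)\<close> are on the right and left
  boundary.  Similarly \<open>V (i, j)\<close> is the spin of the edge below that vertex and
  \<open>V (i - 1, j)\<close> that of the edge above it.
\<close>

definition states ::
  "nat \<Rightarrow> (nat \<Rightarrow> nat) \<Rightarrow> (nat \<Rightarrow> nat) \<Rightarrow> ((nat \<times> nat \<Rightarrow> nat option) \<times> (nat \<times> nat \<Rightarrow> nat set)) set"
  where "states n \<sigma> w = {(h, V).
    h \<in> ({1..n} \<times> {0..n}) \<rightarrow>\<^sub>E ({None} \<union> Some ` {1..n}) \<and>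
    V \<in> ({0..n} \<times> {1..n}) \<rightarrow>\<^sub>E Pow {1..n} \<and>
    (\<forall>j \<in> {1..n}. V (0, j) = {\<sigma> j}) \<and>
    (\<forall>i \<in> {1..n}. h (i, 0) = Some (w i)) \<and>
    (\<forall>i \<in> {1..n}. h (i, n) = None) \<and>
    (\<forall>j \<in> {1..n}. V (n, j) = {})}"

definition partition_function ::
  "nat \<Rightarrow> (nat \<Rightarrow> nat \<Rightarrow> 'a::field weight) \<Rightarrow> (nat \<Rightarrow> nat) \<Rightarrow> (nat \<Rightarrow> nat) \<Rightarrow> 'a"
  where "partition_function n W \<sigma> w =
    (\<Sum>(h, V) \<in> states n \<sigma> w. \<Prod>i \<in> {1..n}. \<Prod>j \<in> {1..n}.
       W i j (h (i, j)) (V (i - 1, j)) (h (i, j - 1)) (V (i, j)))"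

definition Z_square ::
  "nat \<Rightarrow> 'a::field \<Rightarrow> (nat \<Rightarrow> nat) \<Rightarrow> (nat \<Rightarrow> nat) \<Rightarrow> (nat \<Rightarrow> 'a) \<Rightarrow> (nat \<Rightarrow> 'a) \<Rightarrow> 'a"
  where "Z_square n t \<sigma> w x y = partition_function n (\<lambda>i j. K_weight t (x i) (y j)) \<sigma> w"

text \<open>The specialisation \<open>f|\<^sub>v\<close>, i.e. the substitution of \<open>y\<^sub>v\<^sub>(\<^sub>i\<^sub>)\<close> for \<open>x\<^sub>i\<close>.\<close>

definition specialize ::
  "((nat \<Rightarrow> 'a) \<Rightarrow> (nat \<Rightarrow> 'a) \<Rightarrow> 'a) \<Rightarrow> (nat \<Rightarrow> nat) \<Rightarrow> (nat \<Rightarrow> 'a) \<Rightarrow> 'a"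
  where "specialize f v y = f (\<lambda>i. y (v i)) y"

end

theory Submission
  imports Defs
begin

text \<open>
  Write \<open>\<zeta>(u, v)\<close> for the partition function with right boundary \<open>u\<^sup>-\<^sup>1\<close>, specialised
  at \<open>x\<^sub>i = y\<^sub>j\<close> with \<open>j = v\<^sup>-\<^sup>1(i)\<close>.  Replacing \<open>v\<close> by \<open>s\<^sub>i v\<close> interchanges the
  parameters of the rows \<open>i\<close> and \<open>i + 1\<close>, and replacing \<open>u\<close> by \<open>s\<^sub>i u\<close> interchanges the
  colours at their right ends.  Multiplied by the factor \<open>\<phi>\<close>, the recursion for
  \<open>r\<^sub>u\<^sub>,\<^sub>v\<close> is therefore a relation between partition functions in which two adjacent rows
  trade parameters or boundary colours.  This relation (\<open>Z_square_exchange\<close>) is the train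
  argument: an R-vertex attached to the left ends of the two rows, which are uncoloured, contributes
  only a scalar; the Yang--Baxter equation (\<open>yang_baxter\<close>) moves it through the grid column by
  column; and at the right ends it produces a combination of the two orders of the boundary colours.

  The Yang--Baxter equation holds for arbitrarily many colours because the colours of a vertical edge
  that do not take part at a vertex enter its weight only through a product of one factor for the
  left spin and one factor for the right spin.  For two vertices on top of each other these factors
  depend only on the multisets of left and of right spins, so they are common to all terms of the
  equation.  What remains involves at most four colours and is a finite list of polynomial
  identities, indexed by the relative order of these colours and by which of them the vertical edge
  carries.

  The recursion lowers the length of \<open>v\<close>, so that only the values \<open>\<zeta>(u, 1)\<close> have to be
  known: they are \<open>\<phi>\<close> for \<open>u = 1\<close> and 0 otherwise.  They result from cancellations between many
  states and are not visible on single states.  At the other end, for the longest element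
  \<open>u = w\<^sub>0\<close>, at most one state contributes, whatever the parameters are
  (\<open>forced_state\<close>), and its weight is the product of \<open>1 - x\<^sub>i / y\<^sub>j\<close> over \<open>i + j \<le> n\<close>,
  which specialises to 0 unless \<open>v = w\<^sub>0\<close>.  The exchange relation, solved for the term in
  which \<open>u\<close> has been shortened, then propagates triangularity downwards from \<open>w\<^sub>0\<close>:
  \<open>\<zeta>(u, u)\<close> is \<open>\<phi>\<close> at \<open>u\<^sup>-\<^sup>1\<close>, and \<open>\<zeta>(u, v)\<close> vanishes unless \<open>u = v\<close> or \<open>u\<close> is shorter than
  \<open>v\<close> (\<open>zeta_triangular\<close>).  Comparing lengths is coarser than Bruhat order, but it settles
  the case \<open>v = 1\<close>.
\<close>

section \<open>Path sums\<close>

text \<open>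
  The \<open>(s, e)\<close> entry of the product of the transfer matrices \<open>w 1, \<dots>, w k\<close>.  The recursion
  suits inductions along the path; the sum over explicit paths is the form in which a lattice model
  presents itself.  Both the rows and the columns of the lattice are treated in this way.
\<close>

primrec path_sum :: "'s set \<Rightarrow> (nat \<Rightarrow> 's \<Rightarrow> 's \<Rightarrow> 'a::comm_ring_1) \<Rightarrow> nat \<Rightarrow> 's \<Rightarrow> 's \<Rightarrow> 'a" where
  "path_sum S w 0 s e = of_bool (s = e)"
| "path_sum S w (Suc k) s e = (\<Sum>m\<in>S. path_sum S w k s m * w (Suc k) m e)"

definition paths :: "'s set \<Rightarrow> nat \<Rightarrow> 's \<Rightarrow> 's \<Rightarrow> (nat \<Rightarrow> 's) set"
  where "paths S k s e = {p \<in> {0..k} \<rightarrow>\<^sub>E S. p 0 = s \<and> p k = e}"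

lemma path_sum_eq_sum_paths:
  assumes "finite S" "s \<in> S" "e \<in> S"
  shows "path_sum S w k s e = (\<Sum>p\<in>paths S k s e. \<Prod>i\<in>{1..k}. w i (p (i - 1)) (p i))"
  using assms(3)
proof (induction k arbitrary: e)
  case 0
  have "paths S 0 s e = (if s = e then {\<lambda>i\<in>{0}. s} else {})"
    using assms(2) by (auto simp: paths_def PiE_iff extensional_def fun_eq_iff)
  then show ?case by simp
next
  case (Suc k)
  have fin: "finite (paths S k s m)" for m
    unfolding paths_def by (rule finite_subset[OF _ finite_PiE[of "{0..k}" "\<lambda>_. S"]]) (use assms in auto)
  have "path_sum S w (Suc k) s e = (\<Sum>m\<in>S. \<Sum>p\<in>paths S k s m. (\<Prod>i\<in>{1..k}. w i (p (i - 1)) (p i)) * w (Suc k) (p k) e)"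
    by (auto simp: Suc.IH sum_distrib_right paths_def intro!: sum.cong)
  also have "\<dots> = (\<Sum>(m, p)\<in>Sigma S (paths S k s). (\<Prod>i\<in>{1..k}. w i (p (i - 1)) (p i)) * w (Suc k) (p k) e)"
    by (rule sum.Sigma) (use assms fin in auto)
  also have "\<dots> = (\<Sum>p\<in>paths S (Suc k) s e. \<Prod>i\<in>{1..Suc k}. w i (p (i - 1)) (p i))"
  proof (rule sum.reindex_bij_witness[where i = "\<lambda>p. (p k, restrict p {0..k})" and j = "\<lambda>(m, p). p(Suc k := e)"])
    fix a assume "a \<in> Sigma S (paths S k s)"
    then obtain m p where a: "a = (m, p)" "m \<in> S" and p: "p \<in> paths S k s m" by auto
    show "((case a of (m, p) \<Rightarrow> p(Suc k := e)) k, restrict (case a of (m, p) \<Rightarrow> p(Suc k := e)) {0..k}) = a"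
      using p by (auto simp: a paths_def PiE_iff extensional_def fun_eq_iff)
    show "(case a of (m, p) \<Rightarrow> p(Suc k := e)) \<in> paths S (Suc k) s e"
      using p Suc.prems by (auto simp: a paths_def PiE_iff extensional_def)
    have "(\<Prod>i = 1..k. w i ((p(Suc k := e)) (i - 1)) ((p(Suc k := e)) i)) = (\<Prod>i = 1..k. w i (p (i - 1)) (p i))"
      by (intro prod.cong) auto
    then show "(\<Prod>i = 1..Suc k. w i ((case a of (m, p) \<Rightarrow> p(Suc k := e)) (i - 1)) ((case a of (m, p) \<Rightarrow> p(Suc k := e)) i)) =
        (case a of (m, p) \<Rightarrow> (\<Prod>i = 1..k. w i (p (i - 1)) (p i)) * w (Suc k) (p k) e)"
      by (simp add: a prod.nat_ivl_Suc')
  next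
    fix p assume p: "p \<in> paths S (Suc k) s e"
    show "(case (p k, restrict p {0..k}) of (m, p) \<Rightarrow> p(Suc k := e)) = p"
      using p by (fastforce simp: paths_def PiE_iff extensional_def fun_eq_iff le_Suc_eq)
    show "(p k, restrict p {0..k}) \<in> Sigma S (paths S k s)"
      using p by (auto simp: paths_def PiE_iff)
  qed
  finally show ?case .
qed

lemma path_sum_cong:
  assumes "\<And>i x y. 1 \<le> i \<Longrightarrow> i \<le> k \<Longrightarrow> w i x y = w' i x y"
  shows "path_sum S w k s e = path_sum S w' k s e"
  using assms
proof (induction k arbitrary: e)
  case (Suc k)
  have "path_sum S w k s m = path_sum S w' k s m" for m
    using Suc.prems by (intro Suc.IH) auto
  then show ?case using Suc.prems by simp
qed simp

lemma path_sum_add: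
  assumes "finite S" "e \<in> S"
  shows "path_sum S w (j + l) s e = (\<Sum>m\<in>S. path_sum S w j s m * path_sum S (\<lambda>i. w (i + j)) l m e)"
  using assms(2)
proof (induction l arbitrary: e)
  case 0
  then show ?case using assms by (simp add: of_bool_def if_distrib if_distribR sum.delta cong: if_cong)
next
  case (Suc l)
  have "path_sum S w (j + Suc l) s e = (\<Sum>m\<in>S. (\<Sum>m'\<in>S. path_sum S w j s m' * path_sum S (\<lambda>i. w (i + j)) l m' m) * w (Suc (j + l)) m e)"
    using Suc.IH by simp
  also have "\<dots> = (\<Sum>m\<in>S. \<Sum>m'\<in>S. path_sum S w j s m' * path_sum S (\<lambda>i. w (i + j)) l m' m * w (Suc (j + l)) m e)"
    by (simp add: sum_distrib_right)
  also have "\<dots> = (\<Sum>m'\<in>S. \<Sum>m\<in>S. path_sum S w j s m' * path_sum S (\<lambda>i. w (i + j)) l m' m * w (Suc (j + l)) m e)"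
    by (rule sum.swap)
  finally show ?case by (simp add: sum_distrib_left mult.assoc add.commute)
qed

definition two_step :: "'s set \<Rightarrow> (nat \<Rightarrow> 's \<Rightarrow> 's \<Rightarrow> 'a::comm_ring_1) \<Rightarrow> nat \<Rightarrow> 's \<Rightarrow> 's \<Rightarrow> 'a"
  where "two_step S w i s e = (\<Sum>m\<in>S. w i s m * w (Suc i) m e)"

lemma path_sum_two_step:
  assumes "finite S" "e \<in> S" "1 \<le> i" "i < k"
  shows "path_sum S w k s e = (\<Sum>m\<in>S. \<Sum>m'\<in>S. path_sum S w (i - 1) s m * two_step S w i m m' *
     path_sum S (\<lambda>j. w (j + Suc i)) (k - Suc i) m' e)"
proof -
  have k: "k = Suc i + (k - Suc i)" using assms by simp
  have two: "path_sum S w (Suc i) s m' = (\<Sum>m\<in>S. path_sum S w (i - 1) s m * two_step S w i m m')" for m'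
  proof -
    obtain h where h: "i = Suc h" using assms by (cases i) auto
    have "path_sum S w (Suc i) s m' = (\<Sum>x\<in>S. \<Sum>m\<in>S. path_sum S w h s m * w i m x * w (Suc i) x m')"
      by (simp add: h sum_distrib_right)
    also have "\<dots> = (\<Sum>m\<in>S. \<Sum>x\<in>S. path_sum S w h s m * w i m x * w (Suc i) x m')"
      by (rule sum.swap)
    finally show ?thesis by (simp add: h two_step_def sum_distrib_left mult.assoc)
  qed
  have "path_sum S w k s e = (\<Sum>m'\<in>S. path_sum S w (Suc i) s m' * path_sum S (\<lambda>j. w (j + Suc i)) (k - Suc i) m' e)"
    by (subst k, rule path_sum_add) (use assms in auto)
  also have "\<dots> = (\<Sum>m'\<in>S. \<Sum>m\<in>S. path_sum S w (i - 1) s m * two_step S w i m m' *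
     path_sum S (\<lambda>j. w (j + Suc i)) (k - Suc i) m' e)"
    unfolding two by (simp add: sum_distrib_right)
  finally show ?thesis by (subst sum.swap)
qed

text \<open>
  The matrices at sites other than \<open>i\<close> and \<open>i + 1\<close> are the same in all four path sums and
  factor out on both sides, so that a linear relation between products of two adjacent matrices
  extends to whole paths.  Four terms is the shape of the Yang--Baxter equation below.
\<close>

lemma path_sum_local_relation:
  fixes w1 w2 w3 w4 :: "nat \<Rightarrow> 's \<Rightarrow> 's \<Rightarrow> 'a::comm_ring_1"
  assumes S: "finite S" "e \<in> S" and i: "1 \<le> i" "i < k"
    and far: "\<And>j. j \<noteq> i \<Longrightarrow> j \<noteq> Suc i \<Longrightarrow> w2 j = w1 j \<and> w3 j = w1 j \<and> w4 j = w1 j"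
    and near: "\<And>m m'. m \<in> S \<Longrightarrow> m' \<in> S \<Longrightarrow> c1 * two_step S w1 i m m' + c2 * two_step S w2 i m m' =
       c3 * two_step S w3 i m m' + c4 * two_step S w4 i m m'"
  shows "c1 * path_sum S w1 k s e + c2 * path_sum S w2 k s e = c3 * path_sum S w3 k s e + c4 * path_sum S w4 k s e"
proof -
  define P where "P m = path_sum S w1 (i - 1) s m" for m
  define Q where "Q m' = path_sum S (\<lambda>j. w1 (j + Suc i)) (k - Suc i) m' e" for m'
  have expand: "c * path_sum S w k s e = (\<Sum>m\<in>S. \<Sum>m'\<in>S. P m * Q m' * (c * two_step S w i m m'))"
    if "\<And>j. j \<noteq> i \<Longrightarrow> j \<noteq> Suc i \<Longrightarrow> w j = w1 j" for w c
  proof -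
    have "path_sum S w (i - 1) s m = P m" for m
      unfolding P_def by (rule path_sum_cong) (use that i in auto)
    moreover have "path_sum S (\<lambda>j. w (j + Suc i)) (k - Suc i) m' e = Q m'" for m'
      unfolding Q_def by (rule path_sum_cong) (use that i in auto)
    ultimately show ?thesis
      by (simp add: path_sum_two_step[OF S i] sum_distrib_left mult_ac)
  qed
  have "c1 * path_sum S w1 k s e + c2 * path_sum S w2 k s e =
     (\<Sum>m\<in>S. \<Sum>m'\<in>S. P m * Q m' * (c1 * two_step S w1 i m m' + c2 * two_step S w2 i m m'))"
    using far by (simp add: expand sum.distrib distrib_left)
  also have "\<dots> = (\<Sum>m\<in>S. \<Sum>m'\<in>S. P m * Q m' * (c3 * two_step S w3 i m m' + c4 * two_step S w4 i m m'))"
    by (intro sum.cong refl) (simp add: near)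
  also have "\<dots> = c3 * path_sum S w3 k s e + c4 * path_sum S w4 k s e"
    using far by (simp add: expand sum.distrib distrib_left)
  finally show ?thesis .
qed

section \<open>Vertex weights and spectator colours\<close>

text \<open>
  A spectator is a colour \<open>k\<close> of the vertical edge above a vertex that is neither the left nor
  the right spin.  Each of the six kinds of vertex weight is a factor independent of the spectators
  times, for every spectator \<open>k\<close>, a contribution of the left spin and one of the right spin.  For
  example, if the left spin \<open>a\<close> is smaller than the right spin \<open>b\<close>, a spectator between them
  gives \<open>- t\<close> from the left, and one above both gives \<open>(- t) (- 1) = t\<close>.
\<close>

definition left_factor :: "'a::field \<Rightarrow> nat option \<Rightarrow> nat \<Rightarrow> 'a"
  where "left_factor t a k = (case a of None \<Rightarrow> - t | Some c \<Rightarrow> if c < k then - t else 1)"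

definition right_factor :: "nat option \<Rightarrow> nat \<Rightarrow> 'a::field"
  where "right_factor b k = (case b of None \<Rightarrow> 1 | Some c \<Rightarrow> if c < k then - 1 else 1)"

definition allowed :: "nat option \<Rightarrow> nat set \<Rightarrow> nat option \<Rightarrow> bool"
  where "allowed a \<Sigma> b \<longleftrightarrow> a = b \<or> (set_option a \<inter> \<Sigma> = {} \<and> set_option b \<subseteq> \<Sigma>)"

definition below :: "nat option \<Rightarrow> nat set \<Rightarrow> nat option \<Rightarrow> nat set"
  where "below a \<Sigma> b = (if a = b then \<Sigma> else (\<Sigma> \<union> set_option a) - set_option b)"

fun core_weight :: "'a::field \<Rightarrow> 'a \<Rightarrow> nat option \<Rightarrow> nat set \<Rightarrow> nat option \<Rightarrow> 'a" where
  "core_weight t z None \<Sigma> b = 1"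
| "core_weight t z (Some c) \<Sigma> None = - (1 - t) * z"
| "core_weight t z (Some a) \<Sigma> (Some b) =
    (if a = b then - z + (if a \<in> \<Sigma> then t else 1)
     else if a < b then - (1 - t) * z else - (1 - t))"

text \<open>
  The vertex weight without the spectators outside a finite set \<open>E\<close>.  The product runs over
  \<open>E\<close> itself, with trivial factors, rather than over the spectators in \<open>E\<close>: for an explicit
  \<open>E\<close> it then unfolds before anything is known about \<open>\<Sigma>\<close>.
\<close>

definition local_weight :: "'a::field \<Rightarrow> nat set \<Rightarrow> 'a \<Rightarrow> nat option \<Rightarrow> nat set \<Rightarrow> nat option \<Rightarrow> 'a" where
  "local_weight t E z a \<Sigma> b = (if allowed a \<Sigma> b then core_weight t z a \<Sigma> b *
     (\<Prod>k\<in>E. if k \<in> \<Sigma> \<and> a \<noteq> Some k \<and> b \<noteq> Some k then left_factor t a k * right_factor b k else 1) else 0)"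

text \<open>
  The powers of \<open>t\<close> and of \<open>- 1\<close> in the vertex weights count the elements of \<open>\<Sigma>\<close> in
  certain ranges of colours, so each element of \<open>\<Sigma>\<close> can be given its own factor.
\<close>

lemma weight_at_eq:
  assumes "finite \<Sigma>"
  shows "weight_at t z a \<Sigma> b \<Sigma>' = (if allowed a \<Sigma> b \<and> \<Sigma>' = below a \<Sigma> b
    then core_weight t z a \<Sigma> b * (\<Prod>k\<in>{k\<in>\<Sigma>. a \<noteq> Some k \<and> b \<noteq> Some k}. left_factor t a k * right_factor b k)
    else 0)"
proof -
  have filt: "(\<Prod>k\<in>A. if P k then r else (1::'a)) = r ^ card {k\<in>A. P k}" if "finite A" for A P and r :: 'a
    using that by (simp add: prod.If_cases Int_def)
  have sub: "{k \<in> \<Sigma>. k \<noteq> c \<and> k < c} = {k\<in>\<Sigma>. k < c}" "{k \<in> \<Sigma>. k \<noteq> c \<and> c < k} = {k\<in>\<Sigma>. c < k}"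
     "{k \<in> \<Sigma>. c \<noteq> k \<and> k < c} = {k\<in>\<Sigma>. k < c}" "{k \<in> \<Sigma>. c \<noteq> k \<and> c < k} = {k\<in>\<Sigma>. c < k}" for c
    by auto
  show ?thesis
  proof (cases a; cases b)
    assume "a = None" "b = None"
    then show ?thesis by (auto simp: allowed_def below_def left_factor_def right_factor_def)
  next
    fix c assume ab: "a = None" "b = Some c"
    have "(\<Prod>k\<in>{k \<in> \<Sigma>. a \<noteq> Some k \<and> b \<noteq> Some k}. left_factor t a k * right_factor b k)
       = (\<Prod>k\<in>{k\<in>\<Sigma>. c \<noteq> k}. (if k < c then - t else 1) * (if c < k then t else 1))"
      unfolding ab by (intro prod.cong) (auto simp: left_factor_def right_factor_def)
    also have "\<dots> = (- t) ^ card {k \<in> \<Sigma>. k < c} * t ^ card {k \<in> \<Sigma>. k > c}"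
      using assms by (simp add: prod.distrib filt sub)
    finally show ?thesis unfolding ab by (auto simp: allowed_def below_def)
  next
    fix c assume ab: "a = Some c" "b = None"
    have "(\<Prod>k\<in>{k \<in> \<Sigma>. a \<noteq> Some k \<and> b \<noteq> Some k}. left_factor t a k * right_factor b k)
       = (\<Prod>k\<in>{k\<in>\<Sigma>. c \<noteq> k}. (if c < k then - t else 1))"
      unfolding ab by (intro prod.cong) (auto simp: left_factor_def right_factor_def)
    also have "\<dots> = (- t) ^ card {k \<in> \<Sigma>. k > c}"
      using assms by (simp add: filt sub)
    finally show ?thesis unfolding ab by (auto simp: allowed_def below_def)
  next
    fix c d assume ab: "a = Some c" "b = Some d"
    have *: "(\<Prod>k\<in>{k \<in> \<Sigma>. a \<noteq> Some k \<and> b \<noteq> Some k}. left_factor t a k * right_factor b k)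
       = (\<Prod>k\<in>{k\<in>\<Sigma>. c \<noteq> k \<and> d \<noteq> k}. (if c < k \<and> k < d then - t else 1) * (if d < k \<and> k < c then - 1 else 1) * (if c < k \<and> d < k then t else 1))"
      unfolding ab by (intro prod.cong) (auto simp: left_factor_def right_factor_def)
    have sets: "{k \<in> \<Sigma>. c \<noteq> k \<and> d \<noteq> k \<and> c < k \<and> k < d} = {k\<in>\<Sigma>. c < k \<and> k < d}"
      "{k \<in> \<Sigma>. c \<noteq> k \<and> d \<noteq> k \<and> d < k \<and> k < c} = {k\<in>\<Sigma>. d < k \<and> k < c}"
      "{k \<in> \<Sigma>. c \<noteq> k \<and> d \<noteq> k \<and> c < k \<and> d < k} = {k\<in>\<Sigma>. max c d < k}" by auto
    have "(\<Prod>k\<in>{k \<in> \<Sigma>. a \<noteq> Some k \<and> b \<noteq> Some k}. left_factor t a k * right_factor b k)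
       = (- t) ^ card {k\<in>\<Sigma>. c < k \<and> k < d} * (- 1) ^ card {k\<in>\<Sigma>. d < k \<and> k < c} * t ^ card {k\<in>\<Sigma>. max c d < k}"
      unfolding * using assms by (simp add: prod.distrib filt sets)
    moreover have "{k\<in>\<Sigma>. x < k \<and> k < y} = {}" if "y \<le> x" for x y using that by auto
    ultimately show ?thesis unfolding ab
      by (cases rule: linorder_cases[of c d]) (auto simp: allowed_def below_def max_def)
  qed
qed

lemma weight_at_local:
  assumes "finite \<Sigma>" "finite E" "set_option a \<subseteq> E" "set_option b \<subseteq> E"
  shows "weight_at t z a \<Sigma> b \<Sigma>' = (if \<Sigma>' = below a \<Sigma> b
    then (\<Prod>k\<in>\<Sigma> - E. left_factor t a k * right_factor b k) * local_weight t E z a \<Sigma> b else 0)"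
proof -
  let ?f = "\<lambda>k. left_factor t a k * right_factor b k"
  have "{k\<in>\<Sigma>. a \<noteq> Some k \<and> b \<noteq> Some k} = (\<Sigma> - E) \<union> {k\<in>E. k \<in> \<Sigma> \<and> a \<noteq> Some k \<and> b \<noteq> Some k}"
    using assms by auto
  then have "(\<Prod>k\<in>{k\<in>\<Sigma>. a \<noteq> Some k \<and> b \<noteq> Some k}. ?f k) = (\<Prod>k\<in>\<Sigma> - E. ?f k) * (\<Prod>k\<in>{k\<in>E. k \<in> \<Sigma> \<and> a \<noteq> Some k \<and> b \<noteq> Some k}. ?f k)"
    using assms by (simp only:) (intro prod.union_disjoint, auto)
  also have "(\<Prod>k\<in>{k\<in>E. k \<in> \<Sigma> \<and> a \<noteq> Some k \<and> b \<noteq> Some k}. ?f k) = (\<Prod>k\<in>E. if k \<in> \<Sigma> \<and> a \<noteq> Some k \<and> b \<noteq> Some k then ?f k else 1)"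
    using assms(2) by (simp add: prod.If_cases Int_def)
  finally show ?thesis by (simp add: weight_at_eq[OF assms(1)] local_weight_def)
qed

section \<open>The Yang--Baxter equation\<close>

text \<open>
  The entries of the R-matrix for two adjacent rows with parameters \<open>X\<close> (upper row) and
  \<open>X'\<close>: \<open>exch_stay\<close> keeps the two horizontal spins in their rows, \<open>exch_swap\<close> interchanges
  them.  The entries for two colours are those that the recursion for \<open>r\<^sub>u\<^sub>,\<^sub>v\<close> prescribes
  once its denominators are cleared; the Yang--Baxter equation then determines the remaining ones.
  For two equal spins only the sum of the two entries matters, and it is assigned to
  \<open>exch_stay\<close>.
\<close>

fun exch_stay :: "'a::field \<Rightarrow> 'a \<Rightarrow> 'a \<Rightarrow> nat option \<Rightarrow> nat option \<Rightarrow> 'a" where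
  "exch_stay t X X' None None = X' - t * X"
| "exch_stay t X X' None (Some b) = (1 - t) * X"
| "exch_stay t X X' (Some a) None = (1 - t) * X'"
| "exch_stay t X X' (Some a) (Some b) = (if a = b then X - t * X' else if a < b then (1 - t) * X' else (1 - t) * X)"

fun exch_swap :: "'a::field \<Rightarrow> 'a \<Rightarrow> 'a \<Rightarrow> nat option \<Rightarrow> nat option \<Rightarrow> 'a" where
  "exch_swap t X X' None None = 0"
| "exch_swap t X X' None (Some b) = t * (X - X')"
| "exch_swap t X X' (Some a) None = X - X'"
| "exch_swap t X X' (Some a) (Some b) = (if a = b then 0 else if a < b then t * (X - X') else X - X')"

definition pair_weight where
  "pair_weight t E z1 z2 a1 a2 \<Sigma> b1 b2 = local_weight t E z1 a1 \<Sigma> b1 *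
     local_weight t E z2 a2 (below a1 \<Sigma> b1) b2"

text \<open>
  The Yang--Baxter equation for two vertices on top of each other, with spectators outside the four
  horizontal spins stripped off: the R-matrix acts on the left spins \<open>a1\<close>, \<open>a2\<close> in one term
  and on the right spins \<open>b1\<close>, \<open>b2\<close> in the other, and the row parameters are interchanged
  on the way.
\<close>

definition local_yang_baxter_eq where "local_yang_baxter_eq t z1 z2 a1 a2 \<Sigma> b1 b2 \<longleftrightarrow>
   (let E = set_option a1 \<union> set_option a2 \<union> set_option b1 \<union> set_option b2 in
  exch_stay t z1 z2 a1 a2 * pair_weight t E z1 z2 a1 a2 \<Sigma> b1 b2
      + exch_swap t z1 z2 a2 a1 * pair_weight t E z1 z2 a2 a1 \<Sigma> b1 b2
  = exch_stay t z1 z2 b1 b2 * pair_weight t E z2 z1 a1 a2 \<Sigma> b1 b2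
      + exch_swap t z1 z2 b1 b2 * pair_weight t E z2 z1 a1 a2 \<Sigma> b2 b1)"

lemmas local_yang_baxter_unfold = local_yang_baxter_eq_def pair_weight_def local_weight_def
  Let_def allowed_def below_def left_factor_def right_factor_def

lemma local_yang_baxter_left_uncoloured: "local_yang_baxter_eq t z1 z2 None None \<Sigma> b1 b2"
  by (cases b1; cases b2) (auto simp: local_yang_baxter_unfold algebra_simps prod.insert_if)

lemma local_yang_baxter_one_coloured:
  shows "local_yang_baxter_eq t z1 z2 (Some a) None \<Sigma> None None"
    "local_yang_baxter_eq t z1 z2 None (Some a) \<Sigma> None None"
  by (auto simp: local_yang_baxter_unfold algebra_simps prod.insert_if)

lemma local_yang_baxter_two_coloured:
  shows "local_yang_baxter_eq t z1 z2 (Some a) None \<Sigma> (Some b) None"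
    "local_yang_baxter_eq t z1 z2 None (Some a) \<Sigma> (Some b) None"
    "local_yang_baxter_eq t z1 z2 (Some a) None \<Sigma> None (Some b)"
    "local_yang_baxter_eq t z1 z2 None (Some a) \<Sigma> None (Some b)"
    "local_yang_baxter_eq t z1 z2 (Some a) (Some b) \<Sigma> None None"
  by (cases rule: linorder_cases[of a b]; auto simp: local_yang_baxter_unfold algebra_simps prod.insert_if)+

lemma local_yang_baxter_three_coloured:
  shows "local_yang_baxter_eq t z1 z2 (Some a) (Some b) \<Sigma> (Some c) None"
    "local_yang_baxter_eq t z1 z2 (Some a) (Some b) \<Sigma> None (Some c)"
    "local_yang_baxter_eq t z1 z2 (Some a) None \<Sigma> (Some b) (Some c)"
    "local_yang_baxter_eq t z1 z2 None (Some a) \<Sigma> (Some b) (Some c)"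
  by (cases rule: linorder_cases[of a b]; cases rule: linorder_cases[of a c]; cases rule: linorder_cases[of b c];
     simp add: local_yang_baxter_unfold prod.insert_if; auto simp: algebra_simps)+

text \<open>
  Once the relative order of the four colours is fixed, all weights are explicit and each
  combination of memberships in \<open>\<Sigma>\<close> gives a polynomial identity.  Three of the colours are
  ordered first and the inconsistent combinations dropped, so that not all \<open>3\<^sup>6\<close> combinations
  of pairwise comparisons have to be visited.
\<close>

lemma local_yang_baxter_four_coloured: "local_yang_baxter_eq t z1 z2 (Some a) (Some b) \<Sigma> (Some c) (Some d)"
  apply (cases rule: linorder_cases[of a b]; cases rule: linorder_cases[of a c]; cases rule: linorder_cases[of b c]; (linarith)?)
  apply (cases rule: linorder_cases[of c d]; cases rule: linorder_cases[of a d]; cases rule: linorder_cases[of b d]; (linarith)?;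
    simp add: local_yang_baxter_unfold prod.insert_if; auto simp: algebra_simps)+
  done

lemma local_yang_baxter: "local_yang_baxter_eq t z1 z2 a1 a2 \<Sigma> b1 b2"
  by (cases a1; cases a2; cases b1; cases b2) (simp_all add:
      local_yang_baxter_left_uncoloured local_yang_baxter_one_coloured local_yang_baxter_two_coloured
      local_yang_baxter_three_coloured local_yang_baxter_four_coloured)

definition vertex_pair :: "nat set \<Rightarrow> 'a::field \<Rightarrow> 'a \<Rightarrow> 'a \<Rightarrow> nat option \<Rightarrow> nat option \<Rightarrow> nat set \<Rightarrow> nat option \<Rightarrow> nat option \<Rightarrow> nat set \<Rightarrow> 'a"
  where "vertex_pair C t z1 z2 a1 a2 \<Sigma> b1 b2 \<Sigma>' =
    (\<Sum>M\<in>Pow C. weight_at t z1 a1 \<Sigma> b1 M * weight_at t z2 a2 M b2 \<Sigma>')"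

text \<open>
  The vertical edge below two stacked vertices, read off from conservation of every colour.  Unlike
  the composition of the two single steps, this description is visibly symmetric in \<open>a1\<close>,
  \<open>a2\<close> and in \<open>b1\<close>, \<open>b2\<close>, so that all terms of the Yang--Baxter equation end in the same
  vertical spin.
\<close>

definition net_set :: "nat option \<Rightarrow> nat option \<Rightarrow> nat set \<Rightarrow> nat option \<Rightarrow> nat option \<Rightarrow> nat set"
  where "net_set a1 a2 \<Sigma> b1 b2 = {k. of_bool (k \<in> \<Sigma>) + of_bool (a1 = Some k) + of_bool (a2 = Some k)
       = (1::int) + of_bool (b1 = Some k) + of_bool (b2 = Some k)}"

lemma below_mem_iff:
  assumes "allowed a \<Sigma> b"
  shows "of_bool (k \<in> below a \<Sigma> b) = of_bool (k \<in> \<Sigma>) + of_bool (a = Some k) - (of_bool (b = Some k) :: int)"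
  using assms by (cases a; cases b) (auto simp: allowed_def below_def)

lemma below_below:
  assumes "allowed a1 \<Sigma> b1" "allowed a2 (below a1 \<Sigma> b1) b2"
  shows "below a2 (below a1 \<Sigma> b1) b2 = net_set a1 a2 \<Sigma> b1 b2"
proof (rule set_eqI)
  fix k
  have "k \<in> below a2 (below a1 \<Sigma> b1) b2 \<longleftrightarrow> of_bool (k \<in> below a2 (below a1 \<Sigma> b1) b2) = (1::int)" by simp
  then show "k \<in> below a2 (below a1 \<Sigma> b1) b2 \<longleftrightarrow> k \<in> net_set a1 a2 \<Sigma> b1 b2"
    unfolding below_mem_iff[OF assms(2)] below_mem_iff[OF assms(1)] net_set_def mem_Collect_eq by linarith
qed

text \<open>
  The middle edge is determined by the edges around the upper vertex, so at most one term of the sum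
  is nonzero.  A colour outside \<open>E\<close> passes both vertices as a spectator, and its four factors do
  not depend on which left spin is paired with which right spin.
\<close>

lemma vertex_pair_eq:
  assumes C: "finite C" "\<Sigma> \<subseteq> C" and E: "E \<subseteq> C" "set_option a1 \<subseteq> E" "set_option a2 \<subseteq> E" "set_option b1 \<subseteq> E" "set_option b2 \<subseteq> E"
  shows "vertex_pair C t z1 z2 a1 a2 \<Sigma> b1 b2 \<Sigma>' = of_bool (\<Sigma>' = net_set a1 a2 \<Sigma> b1 b2) *
    (\<Prod>k\<in>\<Sigma> - E. left_factor t a1 k * left_factor t a2 k * right_factor b1 k * right_factor b2 k) *
    pair_weight t E z1 z2 a1 a2 \<Sigma> b1 b2"
proof -
  let ?M = "below a1 \<Sigma> b1"
  have fin: "finite \<Sigma>" "finite E" using C E finite_subset by blast+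
  have M: "?M \<subseteq> C" "?M - E = \<Sigma> - E" "finite ?M" using C E fin by (auto simp: below_def)
  have "vertex_pair C t z1 z2 a1 a2 \<Sigma> b1 b2 \<Sigma>' =
    (\<Sum>M\<in>Pow C. if M = ?M then (\<Prod>k\<in>\<Sigma> - E. left_factor t a1 k * right_factor b1 k) * local_weight t E z1 a1 \<Sigma> b1 * weight_at t z2 a2 ?M b2 \<Sigma>' else 0)"
    unfolding vertex_pair_def using fin E by (intro sum.cong) (auto simp: weight_at_local)
  also have "\<dots> = (\<Prod>k\<in>\<Sigma> - E. left_factor t a1 k * right_factor b1 k) * local_weight t E z1 a1 \<Sigma> b1 * weight_at t z2 a2 ?M b2 \<Sigma>'"
    using C M by (simp add: sum.delta')
  also have "\<dots> = of_bool (\<Sigma>' = below a2 ?M b2) * (\<Prod>k\<in>\<Sigma> - E. left_factor t a1 k * left_factor t a2 k * right_factor b1 k * right_factor b2 k) *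
    pair_weight t E z1 z2 a1 a2 \<Sigma> b1 b2"
    using weight_at_local[OF M(3) fin(2) E(3) E(5), of t z2 \<Sigma>']
    by (simp add: pair_weight_def M(2) prod.distrib mult_ac)
  also have "\<dots> = of_bool (\<Sigma>' = net_set a1 a2 \<Sigma> b1 b2) * (\<Prod>k\<in>\<Sigma> - E. left_factor t a1 k * left_factor t a2 k * right_factor b1 k * right_factor b2 k) *
    pair_weight t E z1 z2 a1 a2 \<Sigma> b1 b2"
    by (cases "allowed a1 \<Sigma> b1 \<and> allowed a2 ?M b2") (auto simp: below_below pair_weight_def local_weight_def)
  finally show ?thesis .
qed

text \<open>
  All four terms contain the same spectator factor and the same condition on \<open>\<Sigma>'\<close>, so the
  equation follows from the one in which only the colours of the horizontal spins are left.
\<close>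

theorem yang_baxter:
  assumes C: "finite C" "\<Sigma> \<subseteq> C" and E: "set_option a1 \<subseteq> C" "set_option a2 \<subseteq> C" "set_option b1 \<subseteq> C" "set_option b2 \<subseteq> C"
  shows "exch_stay t z1 z2 a1 a2 * vertex_pair C t z1 z2 a1 a2 \<Sigma> b1 b2 \<Sigma>'
      + exch_swap t z1 z2 a2 a1 * vertex_pair C t z1 z2 a2 a1 \<Sigma> b1 b2 \<Sigma>'
  = exch_stay t z1 z2 b1 b2 * vertex_pair C t z2 z1 a1 a2 \<Sigma> b1 b2 \<Sigma>'
      + exch_swap t z1 z2 b1 b2 * vertex_pair C t z2 z1 a1 a2 \<Sigma> b2 b1 \<Sigma>'"
proof -
  define E where "E = set_option a1 \<union> set_option a2 \<union> set_option b1 \<union> set_option b2"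
  define p where "p = of_bool (\<Sigma>' = net_set a1 a2 \<Sigma> b1 b2) * (\<Prod>k\<in>\<Sigma> - E. left_factor t a1 k * left_factor t a2 k * right_factor b1 k * right_factor b2 k)"
  have net: "net_set a2 a1 \<Sigma> b1 b2 = net_set a1 a2 \<Sigma> b1 b2" "net_set a1 a2 \<Sigma> b2 b1 = net_set a1 a2 \<Sigma> b1 b2"
    by (auto simp: net_set_def algebra_simps)
  have EE: "E \<subseteq> C" "set_option a1 \<subseteq> E" "set_option a2 \<subseteq> E" "set_option b1 \<subseteq> E" "set_option b2 \<subseteq> E"
    using assms by (auto simp: E_def)
  have pair: "vertex_pair C t x y a1 a2 \<Sigma> b1 b2 \<Sigma>' = p * pair_weight t E x y a1 a2 \<Sigma> b1 b2"
     "vertex_pair C t x y a2 a1 \<Sigma> b1 b2 \<Sigma>' = p * pair_weight t E x y a2 a1 \<Sigma> b1 b2"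
     "vertex_pair C t x y a1 a2 \<Sigma> b2 b1 \<Sigma>' = p * pair_weight t E x y a1 a2 \<Sigma> b2 b1" for x y
    unfolding p_def using EE by (simp_all add: vertex_pair_eq[OF C, of E] net mult_ac)
  have "exch_stay t z1 z2 a1 a2 * pair_weight t E z1 z2 a1 a2 \<Sigma> b1 b2
      + exch_swap t z1 z2 a2 a1 * pair_weight t E z1 z2 a2 a1 \<Sigma> b1 b2
  = exch_stay t z1 z2 b1 b2 * pair_weight t E z2 z1 a1 a2 \<Sigma> b1 b2
      + exch_swap t z1 z2 b1 b2 * pair_weight t E z2 z1 a1 a2 \<Sigma> b2 b1"
    using local_yang_baxter[of t z1 z2 a1 a2 \<Sigma> b1 b2] unfolding local_yang_baxter_eq_def Let_def E_def .
  from arg_cong[OF this, of "\<lambda>x. p * x"] show ?thesis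
    unfolding pair by (simp add: distrib_left mult_ac)
qed

section \<open>The exchange relation for adjacent rows\<close>

definition row_states :: "nat \<Rightarrow> (nat \<Rightarrow> nat option) set"
  where "row_states n = {1..n} \<rightarrow>\<^sub>E ({None} \<union> Some ` {1..n})"

lemma finite_row_states [simp]: "finite (row_states n)"
  unfolding row_states_def by (intro finite_PiE) auto

text \<open>
  The grid as a path of row configurations, read column by column from right to left.  Once the
  horizontal spins are fixed, the vertical spins of different columns are independent of each other,
  and each column is itself a path read from top to bottom.
\<close>

lemma partition_function_eq_path_sum:
  assumes \<sigma>: "\<And>j. j \<in> {1..n} \<Longrightarrow> \<sigma> j \<in> {1..n}" and w: "\<And>i. i \<in> {1..n} \<Longrightarrow> w i \<in> {1..n}"
  shows "partition_function n W \<sigma> w =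
    path_sum (row_states n) (\<lambda>j b a. path_sum (Pow {1..n}) (\<lambda>i S S'. W i j (a i) S (b i) S') n {\<sigma> j} {}) n
      (\<lambda>i\<in>{1..n}. Some (w i)) (\<lambda>i\<in>{1..n}. None)"
proof -
  let ?b = "\<lambda>i\<in>{1..n}. Some (w i)" and ?a = "\<lambda>i\<in>{1..n}. None :: nat option"
  let ?R = "row_states n" and ?P = "Pow {1..n}"
  let ?H = "paths ?R n ?b ?a" and ?V = "\<lambda>j. paths ?P n {\<sigma> j} {}"
  have fin: "finite (?V j)" for j
    unfolding paths_def by (rule finite_subset[OF _ finite_PiE[of "{0..n}" "\<lambda>_. ?P"]]) auto
  have "path_sum ?R (\<lambda>j b a. path_sum ?P (\<lambda>i S S'. W i j (a i) S (b i) S') n {\<sigma> j} {}) n ?b ?a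
     = (\<Sum>H\<in>?H. \<Prod>j\<in>{1..n}. path_sum ?P (\<lambda>i S S'. W i j (H j i) S (H (j - 1) i) S') n {\<sigma> j} {})"
    using w by (intro path_sum_eq_sum_paths finite_row_states) (auto simp: row_states_def)
  also have "\<dots> = (\<Sum>H\<in>?H. \<Prod>j\<in>{1..n}. \<Sum>V\<in>?V j. \<Prod>i\<in>{1..n}. W i j (H j i) (V (i - 1)) (H (j - 1) i) (V i))"
    using \<sigma> by (intro sum.cong prod.cong refl path_sum_eq_sum_paths) auto
  also have "\<dots> = (\<Sum>H\<in>?H. \<Sum>V\<in>PiE {1..n} ?V. \<Prod>j\<in>{1..n}. \<Prod>i\<in>{1..n}. W i j (H j i) (V j (i - 1)) (H (j - 1) i) (V j i))"
    using fin by (intro sum.cong refl prod_sum_PiE) auto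
  also have "\<dots> = (\<Sum>(H, V)\<in>?H \<times> PiE {1..n} ?V. \<Prod>j\<in>{1..n}. \<Prod>i\<in>{1..n}. W i j (H j i) (V j (i - 1)) (H (j - 1) i) (V j i))"
    by (rule sum.cartesian_product)
  also have "\<dots> = (\<Sum>(h, V) \<in> states n \<sigma> w. \<Prod>i \<in> {1..n}. \<Prod>j \<in> {1..n}.
       W i j (h (i, j)) (V (i - 1, j)) (h (i, j - 1)) (V (i, j)))"
  proof (rule sum.reindex_bij_witness[where
        i = "\<lambda>(h, V). (\<lambda>j\<in>{0..n}. \<lambda>i\<in>{1..n}. h (i, j), \<lambda>j\<in>{1..n}. \<lambda>i\<in>{0..n}. V (i, j))" and
        j = "\<lambda>(H, V). (\<lambda>(i, j)\<in>{1..n} \<times> {0..n}. H j i, \<lambda>(i, j)\<in>{0..n} \<times> {1..n}. V j i)"])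
    fix p assume "p \<in> ?H \<times> PiE {1..n} ?V"
    then obtain H V where p: "p = (H, V)" and H: "H \<in> ?H" and V: "V \<in> PiE {1..n} ?V" by auto
    have H': "\<And>j. j \<le> n \<Longrightarrow> H j \<in> row_states n" "\<And>j. \<not> j \<le> n \<Longrightarrow> H j = undefined" "H 0 = ?b" "H n = ?a"
      using H by (auto simp: paths_def PiE_iff extensional_def)
    have V': "\<And>j i. j \<in> {1..n} \<Longrightarrow> i \<le> n \<Longrightarrow> V j i \<subseteq> {1..n}" "\<And>j i. j \<in> {1..n} \<Longrightarrow> \<not> i \<le> n \<Longrightarrow> V j i = undefined"
       "\<And>j. j \<notin> {1..n} \<Longrightarrow> V j = undefined" "\<And>j. j \<in> {1..n} \<Longrightarrow> V j 0 = {\<sigma> j}"  "\<And>j. j \<in> {1..n} \<Longrightarrow> V j n = {}"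
      using V by (auto simp: paths_def PiE_iff extensional_def)
    have Hin: "H j i \<in> {None} \<union> Some ` {1..n}" if "j \<le> n" "i \<in> {1..n}" for i j
      using H'(1)[OF that(1)] that(2) unfolding row_states_def by (rule PiE_mem)
    have Hout: "H j i = undefined" if "j \<le> n" "i \<notin> {1..n}" for i j
      using H'(1)[OF that(1)] that(2) unfolding row_states_def by (rule PiE_arb)
    show "(case (case p of (H, V) \<Rightarrow> (\<lambda>(i, j)\<in>{1..n} \<times> {0..n}. H j i, \<lambda>(i, j)\<in>{0..n} \<times> {1..n}. V j i)) of
          (h, V) \<Rightarrow> (\<lambda>j\<in>{0..n}. \<lambda>i\<in>{1..n}. h (i, j), \<lambda>j\<in>{1..n}. \<lambda>i\<in>{0..n}. V (i, j))) = p"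
      using H'(2) Hout V'(2,3) by (auto simp: p fun_eq_iff restrict_def)
    have "(\<lambda>(i, j)\<in>{1..n} \<times> {0..n}. H j i) \<in> ({1..n} \<times> {0..n}) \<rightarrow>\<^sub>E ({None} \<union> Some ` {1..n})"
    proof (rule restrict_PiE_iff[THEN iffD2], rule ballI)
      fix e assume "e \<in> {1..n} \<times> {0..n}"
      then show "(case e of (i, j) \<Rightarrow> H j i) \<in> {None} \<union> Some ` {1..n}"
        using Hin[of "snd e" "fst e"] by (cases e) simp
    qed
    moreover have "(\<lambda>(i, j)\<in>{0..n} \<times> {1..n}. V j i) \<in> ({0..n} \<times> {1..n}) \<rightarrow>\<^sub>E Pow {1..n}"
    proof (rule restrict_PiE_iff[THEN iffD2], rule ballI)
      fix e assume "e \<in> {0..n} \<times> {1..n}"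
      then show "(case e of (i, j) \<Rightarrow> V j i) \<in> Pow {1..n}"
        using V'(1)[of "snd e" "fst e"] by (cases e) simp
    qed
    ultimately show "(case p of (H, V) \<Rightarrow> (\<lambda>(i, j)\<in>{1..n} \<times> {0..n}. H j i, \<lambda>(i, j)\<in>{0..n} \<times> {1..n}. V j i)) \<in> states n \<sigma> w"
      using V'(4,5) H'(3,4) by (auto simp: p states_def)
    show "(case (case p of (H, V) \<Rightarrow> (\<lambda>(i, j)\<in>{1..n} \<times> {0..n}. H j i, \<lambda>(i, j)\<in>{0..n} \<times> {1..n}. V j i)) of
         (h, V) \<Rightarrow> \<Prod>i \<in> {1..n}. \<Prod>j \<in> {1..n}. W i j (h (i, j)) (V (i - 1, j)) (h (i, j - 1)) (V (i, j))) =
        (case p of (H, V) \<Rightarrow> \<Prod>j\<in>{1..n}. \<Prod>i\<in>{1..n}. W i j (H j i) (V j (i - 1)) (H (j - 1) i) (V j i))"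
      unfolding p by (subst prod.swap) (auto intro!: prod.cong)
  next
    fix p assume "p \<in> states n \<sigma> w"
    then obtain h V where p: "p = (h, V)" and h: "h \<in> ({1..n} \<times> {0..n}) \<rightarrow>\<^sub>E ({None} \<union> Some ` {1..n})"
      and V: "V \<in> ({0..n} \<times> {1..n}) \<rightarrow>\<^sub>E Pow {1..n}"
      and bd: "\<forall>j \<in> {1..n}. V (0, j) = {\<sigma> j}" "\<forall>i \<in> {1..n}. h (i, 0) = Some (w i)"
         "\<forall>i \<in> {1..n}. h (i, n) = None" "\<forall>j \<in> {1..n}. V (n, j) = {}"
      by (auto simp: states_def)
    show "(case (case p of (h, V) \<Rightarrow> (\<lambda>j\<in>{0..n}. \<lambda>i\<in>{1..n}. h (i, j), \<lambda>j\<in>{1..n}. \<lambda>i\<in>{0..n}. V (i, j))) of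
      (H, V) \<Rightarrow> (\<lambda>(i, j)\<in>{1..n} \<times> {0..n}. H j i, \<lambda>(i, j)\<in>{0..n} \<times> {1..n}. V j i)) = p"
      using PiE_arb[OF h] PiE_arb[OF V] by (auto simp: p fun_eq_iff restrict_def)
    have "(\<lambda>j\<in>{0..n}. \<lambda>i\<in>{1..n}. h (i, j)) \<in> ?H"
      using h bd by (auto simp: paths_def row_states_def fun_eq_iff restrict_def PiE_iff extensional_def)
    moreover have "(\<lambda>i\<in>{0..n}. V (i, j)) \<in> ?V j" if "j \<in> {1..n}" for j
      using V bd that by (auto simp: paths_def restrict_def PiE_iff extensional_def)
    ultimately show "(case p of (h, V) \<Rightarrow> (\<lambda>j\<in>{0..n}. \<lambda>i\<in>{1..n}. h (i, j), \<lambda>j\<in>{1..n}. \<lambda>i\<in>{0..n}. V (i, j))) \<in> ?H \<times> PiE {1..n} ?V"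
      by (auto simp: p)
  qed
  finally show ?thesis unfolding partition_function_def by simp
qed

lemma exch_scale:
  "exch_stay t (X * c) (X' * c) a b = c * exch_stay t X X' a b"
  "exch_swap t (X * c) (X' * c) a b = c * exch_swap t X X' a b"
  by (cases a; cases b; simp add: algebra_simps)+

text \<open>
  The vertex weights involve \<open>x\<close> only through \<open>x c\<close>, where \<open>c\<close> is the inverse of the
  column parameter.  The entries of the R-matrix are homogeneous of degree one in the row parameters,
  so \<open>c\<close> cancels and the same R-matrix serves for all columns.
\<close>

lemma column_exchange:
  fixes t c :: "'a::field" and \<Sigma> \<Sigma>' :: "nat set"
  assumes i: "1 \<le> i" "i < n" and a: "a \<in> row_states n" and b: "b \<in> row_states n" and c: "c \<noteq> 0" and S: "\<Sigma>' \<subseteq> {1..n}"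
  defines "s \<equiv> transpose i (i + 1)"
  defines "K \<equiv> \<lambda>x a b. path_sum (Pow {1..n}) (\<lambda>j S S'. weight_at t (x j * c) (a j) S (b j) S') n \<Sigma> \<Sigma>'"
  shows "exch_stay t (x i) (x (i+1)) (a i) (a (i+1)) * K x a b
      + exch_swap t (x i) (x (i+1)) (a (i+1)) (a i) * K x (a \<circ> s) b
    = exch_stay t (x i) (x (i+1)) (b i) (b (i+1)) * K (x \<circ> s) a b
      + exch_swap t (x i) (x (i+1)) (b i) (b (i+1)) * K (x \<circ> s) a (b \<circ> s)"
proof -
  have col: "set_option (r j) \<subseteq> {1..n}" if "r \<in> row_states n" "j \<in> {1..n}" for r j
    using PiE_mem[OF that(1)[unfolded row_states_def] that(2)] by auto
  have ii: "i \<in> {1..n}" "Suc i \<in> {1..n}" using i by auto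
  have "exch_stay t (x i * c) (x (i+1) * c) (a i) (a (i+1)) * K x a b
      + exch_swap t (x i * c) (x (i+1) * c) (a (i+1)) (a i) * K x (a \<circ> s) b
    = exch_stay t (x i * c) (x (i+1) * c) (b i) (b (i+1)) * K (x \<circ> s) a b
      + exch_swap t (x i * c) (x (i+1) * c) (b i) (b (i+1)) * K (x \<circ> s) a (b \<circ> s)"
    unfolding K_def
  proof (rule path_sum_local_relation[where i = i])
    fix m m' assume m: "m \<in> Pow {1..n}"
    show "exch_stay t (x i * c) (x (i+1) * c) (a i) (a (i+1)) * two_step (Pow {1..n}) (\<lambda>j S S'. weight_at t (x j * c) (a j) S (b j) S') i m m' +
       exch_swap t (x i * c) (x (i+1) * c) (a (i+1)) (a i) * two_step (Pow {1..n}) (\<lambda>j S S'. weight_at t (x j * c) ((a \<circ> s) j) S (b j) S') i m m' =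
       exch_stay t (x i * c) (x (i+1) * c) (b i) (b (i+1)) * two_step (Pow {1..n}) (\<lambda>j S S'. weight_at t ((x \<circ> s) j * c) (a j) S (b j) S') i m m' +
       exch_swap t (x i * c) (x (i+1) * c) (b i) (b (i+1)) * two_step (Pow {1..n}) (\<lambda>j S S'. weight_at t ((x \<circ> s) j * c) (a j) S ((b \<circ> s) j) S') i m m'"
      using yang_baxter[of "{1..n}" m "a i" "a (i+1)" "b i" "b (i+1)" t "x i * c" "x (i+1) * c" m'] m col[OF a] col[OF b] ii
      by (simp add: two_step_def vertex_pair_def s_def)
  qed (use i S in \<open>auto simp: s_def transpose_def\<close>)
  then show ?thesis unfolding exch_scale using c by (simp flip: distrib_left add: mult.assoc)
qed

lemma row_states_swap:
  assumes "a \<in> row_states n" "1 \<le> i" "i < n"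
  shows "a \<circ> transpose i (i + 1) \<in> row_states n"
  using assms by (auto simp: row_states_def PiE_iff extensional_def transpose_def)

text \<open>
  The train argument, by induction on the number \<open>k\<close> of columns counted from the right: the
  R-matrix to the right of the columns can be traded for one to their left.
\<close>

lemma rows_exchange:
  fixes t :: "'a::field" and c :: "nat \<Rightarrow> 'a" and \<Sigma> :: "nat \<Rightarrow> nat set"
  assumes i: "1 \<le> i" "i < n" and y: "\<And>j. 1 \<le> j \<Longrightarrow> j \<le> k \<Longrightarrow> c j \<noteq> 0"
    and a: "a \<in> row_states n" and b: "b \<in> row_states n"
  defines "s \<equiv> transpose i (i + 1)"
  defines "K \<equiv> \<lambda>x j b a. path_sum (Pow {1..n}) (\<lambda>l S S'. weight_at t (x l * c j) (a l) S (b l) S') n (\<Sigma> j) {}"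
  defines "T \<equiv> \<lambda>x. path_sum (row_states n) (K x)"
  shows "exch_stay t (x i) (x (i+1)) (b i) (b (i+1)) * T (x \<circ> s) k b a
      + exch_swap t (x i) (x (i+1)) (b i) (b (i+1)) * T (x \<circ> s) k (b \<circ> s) a
     = exch_stay t (x i) (x (i+1)) (a i) (a (i+1)) * T x k b a
      + exch_swap t (x i) (x (i+1)) (a (i+1)) (a i) * T x k b (a \<circ> s)"
  using y a
proof (induction k arbitrary: a)
  case 0
  have ss: "r \<circ> s \<circ> s = r" for r :: "nat \<Rightarrow> nat option" by (simp add: s_def comp_assoc)
  then have eq: "b \<circ> s = a \<longleftrightarrow> b = a \<circ> s" by metis
  have "exch_stay t (x i) (x (i+1)) (b i) (b (i+1)) * of_bool (b = a) = exch_stay t (x i) (x (i+1)) (a i) (a (i+1)) * of_bool (b = a)"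
    by (cases "b = a") auto
  moreover have "exch_swap t (x i) (x (i+1)) (b i) (b (i+1)) * of_bool (b \<circ> s = a) = exch_swap t (x i) (x (i+1)) (a (i+1)) (a i) * of_bool (b = a \<circ> s)"
    unfolding eq by (cases "b = a \<circ> s") (auto simp: s_def)
  ultimately show ?case unfolding T_def path_sum.simps by (simp only:)
next
  case (Suc k)
  let ?A = "\<lambda>r. exch_stay t (x i) (x (i+1)) (r i) (r (i+1))"
  let ?B = "\<lambda>r. exch_swap t (x i) (x (i+1)) (r i) (r (i+1))"
  let ?R = "row_states n"
  have ss: "r \<circ> s \<circ> s = r" for r :: "nat \<Rightarrow> nat option" by (simp add: s_def comp_assoc)
  have s_at: "s i = Suc i" "s (Suc i) = i" by (simp_all add: s_def)
  have sw: "(r \<circ> s) i = r (Suc i)" "(r \<circ> s) (Suc i) = r i" for r :: "nat \<Rightarrow> nat option" by (simp_all add: s_def)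
  have Rs: "r \<circ> s \<in> ?R" if "r \<in> ?R" for r using row_states_swap[OF that i] by (simp add: s_def)
  have IH: "?A b * T (x \<circ> s) k b m + ?B b * T (x \<circ> s) k (b \<circ> s) m = ?A m * T x k b m + ?B (m \<circ> s) * T x k b (m \<circ> s)"
    if "m \<in> ?R" for m
    using Suc.IH[OF Suc.prems(1) that] by (simp add: sw del: o_apply)
  have col: "?A a * K x (Suc k) m a + ?B (a \<circ> s) * K x (Suc k) m (a \<circ> s) = ?A m * K (x \<circ> s) (Suc k) m a + ?B m * K (x \<circ> s) (Suc k) (m \<circ> s) a"
    if "m \<in> ?R" for m
    using column_exchange[OF i Suc.prems(2) that, of "c (Suc k)" "{}" t x "\<Sigma> (Suc k)", folded s_def] Suc.prems(1)[of "Suc k"]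
    unfolding K_def by (simp add: s_at)
  have "?A b * T (x \<circ> s) (Suc k) b a + ?B b * T (x \<circ> s) (Suc k) (b \<circ> s) a
     = (\<Sum>m\<in>?R. (?A b * T (x \<circ> s) k b m + ?B b * T (x \<circ> s) k (b \<circ> s) m) * K (x \<circ> s) (Suc k) m a)"
    unfolding T_def by (simp add: sum_distrib_left sum.distrib distrib_right mult.assoc del: o_apply)
  also have "\<dots> = (\<Sum>m\<in>?R. (?A m * T x k b m + ?B (m \<circ> s) * T x k b (m \<circ> s)) * K (x \<circ> s) (Suc k) m a)"
    by (intro sum.cong refl) (simp only: IH)
  also have "\<dots> = (\<Sum>m\<in>?R. ?A m * T x k b m * K (x \<circ> s) (Suc k) m a) + (\<Sum>m\<in>?R. ?B (m \<circ> s) * T x k b (m \<circ> s) * K (x \<circ> s) (Suc k) m a)"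
    by (simp add: distrib_right sum.distrib del: o_apply)
  \<comment> \<open>Renaming the intermediate row configuration moves the interchange of its spins onto the new column.\<close>
  also have "(\<Sum>m\<in>?R. ?B (m \<circ> s) * T x k b (m \<circ> s) * K (x \<circ> s) (Suc k) m a)
     = (\<Sum>m\<in>?R. ?B m * T x k b m * K (x \<circ> s) (Suc k) (m \<circ> s) a)"
    by (rule sum.reindex_bij_witness[where i = "\<lambda>m. m \<circ> s" and j = "\<lambda>m. m \<circ> s"]) (use Rs ss in \<open>simp_all del: o_apply\<close>)
  also have "(\<Sum>m\<in>?R. ?A m * T x k b m * K (x \<circ> s) (Suc k) m a) + \<dots>
     = (\<Sum>m\<in>?R. T x k b m * (?A m * K (x \<circ> s) (Suc k) m a + ?B m * K (x \<circ> s) (Suc k) (m \<circ> s) a))"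
    by (simp add: sum.distrib distrib_left mult_ac del: o_apply)
  also have "\<dots> = (\<Sum>m\<in>?R. T x k b m * (?A a * K x (Suc k) m a + ?B (a \<circ> s) * K x (Suc k) m (a \<circ> s)))"
    by (intro sum.cong refl) (simp only: col)
  also have "\<dots> = ?A a * T x (Suc k) b a + ?B (a \<circ> s) * T x (Suc k) b (a \<circ> s)"
    unfolding T_def by (simp add: sum_distrib_left sum.distrib distrib_left mult_ac del: o_apply)
  finally show ?case by (simp add: sw del: o_apply)
qed

text \<open>
  At the left boundary both spins are uncoloured, so there the R-matrix is the scalar
  \<open>x\<^sub>i\<^sub>+\<^sub>1 - t x\<^sub>i\<close>.
\<close>

lemma Z_square_exchange:
  fixes t :: "'a::field"
  assumes \<sigma>: "\<And>j. j \<in> {1..n} \<Longrightarrow> \<sigma> j \<in> {1..n}" and w: "\<And>j. j \<in> {1..n} \<Longrightarrow> w j \<in> {1..n}"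
    and i: "1 \<le> i" "i < n" and y: "\<And>j. j \<in> {1..n} \<Longrightarrow> y j \<noteq> 0"
  defines "s \<equiv> transpose i (i + 1)"
  shows "(x (i+1) - t * x i) * Z_square n t \<sigma> w x y =
    exch_stay t (x i) (x (i+1)) (Some (w i)) (Some (w (i+1))) * Z_square n t \<sigma> w (x \<circ> s) y +
    exch_swap t (x i) (x (i+1)) (Some (w i)) (Some (w (i+1))) * Z_square n t \<sigma> (w \<circ> s) (x \<circ> s) y"
proof -
  let ?b = "\<lambda>w. \<lambda>i\<in>{1..n}. Some (w i)" and ?a = "\<lambda>i\<in>{1..n}. None :: nat option"
  have ws: "(w \<circ> s) j \<in> {1..n}" if "j \<in> {1..n}" for j
    using that i w by (auto simp: s_def transpose_def)
  have bs: "?b w \<circ> s = ?b (w \<circ> s)"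
    using i by (auto simp: s_def transpose_def fun_eq_iff)
  have R: "?b w \<in> row_states n" "?a \<in> row_states n" using w by (auto simp: row_states_def)
  have Z: "Z_square n t \<sigma> w' x' y = path_sum (row_states n)
      (\<lambda>j b a. path_sum (Pow {1..n}) (\<lambda>i S S'. weight_at t (x' i * inverse (y j)) (a i) S (b i) S') n {\<sigma> j} {}) n (?b w') ?a"
    if "\<And>j. j \<in> {1..n} \<Longrightarrow> w' j \<in> {1..n}" for x' w'
    unfolding Z_square_def K_weight_def by (rule partition_function_eq_path_sum) (use \<sigma> that in auto)
  have at_i: "?b w i = Some (w i)" "?b w (i + 1) = Some (w (i + 1))" "?a i = None" "?a (i + 1) = None"
    using i by auto
  define T where "T x' = path_sum (row_states n) (\<lambda>j b a. path_sum (Pow {1..n})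
    (\<lambda>i S S'. weight_at t (x' i * inverse (y j)) (a i) S (b i) S') n {\<sigma> j} {})" for x'
  have ZT: "Z_square n t \<sigma> w x' y = T x' n (?b w) ?a" "Z_square n t \<sigma> (w \<circ> s) x' y = T x' n (?b w \<circ> s) ?a" for x'
    unfolding T_def bs by (rule Z, use w ws in blast)+
  have "exch_stay t (x i) (x (i+1)) (?b w i) (?b w (i+1)) * T (x \<circ> s) n (?b w) ?a +
      exch_swap t (x i) (x (i+1)) (?b w i) (?b w (i+1)) * T (x \<circ> s) n (?b w \<circ> s) ?a
    = exch_stay t (x i) (x (i+1)) (?a i) (?a (i+1)) * T x n (?b w) ?a
      + exch_swap t (x i) (x (i+1)) (?a (i+1)) (?a i) * T x n (?b w) (?a \<circ> s)"
    unfolding T_def s_def by (rule rows_exchange[OF i _ R(2,1)]) (use y in auto)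
  then show ?thesis
    unfolding ZT at_i by simp
qed

section \<open>Inversions and ascents of permutations\<close>

text \<open>
  Both permutations have the same sum of values, so a pointwise inequality cannot be strict anywhere.
\<close>

lemma permutes_eq_if_le:
  fixes f g :: "nat \<Rightarrow> nat"
  assumes "f permutes {1..n}" "g permutes {1..n}" and le: "\<And>i. i \<in> {1..n} \<Longrightarrow> f i \<le> g i"
  shows "f = g"
proof
  fix i
  have "sum f {1..n} = sum (\<lambda>i. i) {1..n}" "sum g {1..n} = sum (\<lambda>i. i) {1..n}"
    using sum.permute[OF assms(1), of "\<lambda>i. i"] sum.permute[OF assms(2), of "\<lambda>i. i"] by (simp_all add: o_def)
  then have "f j = g j" if "j \<in> {1..n}" for j
    by (intro sum_mono_inv[OF _ le that]) auto
  then show "f i = g i"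
    by (cases "i \<in> {1..n}") (auto simp: permutes_not_in[OF assms(1)] permutes_not_in[OF assms(2)])
qed

lemma increasing_permutes_eq_id:
  fixes g :: "nat \<Rightarrow> nat"
  assumes g: "g permutes {1..n}" and inc: "\<And>i. 1 \<le> i \<Longrightarrow> i < n \<Longrightarrow> g i < g (i + 1)"
  shows "g = id"
proof (rule permutes_eq_if_le[OF permutes_id g, symmetric])
  fix i assume "i \<in> {1..n}"
  then have "1 \<le> i" "i \<le> n" by auto
  then show "id i \<le> g i"
  proof (induction i rule: dec_induct)
    case base then show ?case using permutes_in_image[OF g, of 1] by auto
  next
    case (step i) then show ?case using inc[of i] by simp
  qed
qed

text \<open>
  The longest element \<open>w\<^sub>0\<close>.
\<close>

definition rev_perm :: "nat \<Rightarrow> nat \<Rightarrow> nat"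
  where "rev_perm n i = (if i \<in> {1..n} then n + 1 - i else i)"

lemma rev_perm_rev_perm [simp]: "rev_perm n (rev_perm n i) = i"
  by (auto simp: rev_perm_def)

lemma rev_perm_permutes: "rev_perm n permutes {1..n}"
  unfolding permutes_def by (metis rev_perm_def rev_perm_rev_perm)

lemma inv_rev_perm: "inv (rev_perm n) = rev_perm n"
  by (rule inv_unique_comp) (auto simp: fun_eq_iff)

lemma decreasing_permutes_eq_rev_perm:
  assumes g: "g permutes {1..n}" and dec: "\<And>i. 1 \<le> i \<Longrightarrow> i < n \<Longrightarrow> g (i + 1) < g i"
  shows "g = rev_perm n"
proof -
  have "g \<circ> rev_perm n = id"
  proof (rule increasing_permutes_eq_id[OF permutes_compose[OF rev_perm_permutes g]])
    fix i assume i: "1 \<le> i" "i < n"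
    then have "rev_perm n i = rev_perm n (i + 1) + 1" "1 \<le> rev_perm n (i + 1)" "rev_perm n (i + 1) < n"
      by (auto simp: rev_perm_def)
    then show "(g \<circ> rev_perm n) i < (g \<circ> rev_perm n) (i + 1)"
      using dec[of "rev_perm n (i + 1)"] by simp
  qed
  then show ?thesis by (metis comp_def id_apply rev_perm_rev_perm ext)
qed

lemma exists_ascent:
  assumes u: "u permutes {1..n}" and "u \<noteq> rev_perm n"
  shows "\<exists>i. 1 \<le> i \<and> i < n \<and> inv u i < inv u (i + 1)"
proof (rule ccontr)
  assume no: "\<not> ?thesis"
  have iu: "inv u permutes {1..n}" using u by (rule permutes_inv)
  have "inv u (i + 1) < inv u i" if "1 \<le> i" "i < n" for i
  proof -
    have "\<not> inv u i < inv u (i + 1)" using no that by blast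
    moreover have "inv u i \<noteq> inv u (i + 1)" by (simp add: inj_eq[OF permutes_inj[OF iu]])
    ultimately show ?thesis by linarith
  qed
  then have "inv u = rev_perm n" by (rule decreasing_permutes_eq_rev_perm[OF iu])
  then show False using assms inv_rev_perm inv_inv_eq[OF permutes_bij[OF u]] by metis
qed

lemma exists_descent:
  fixes u :: "nat \<Rightarrow> nat"
  assumes u: "u permutes {1..n}" and "u \<noteq> id"
  shows "\<exists>i. 1 \<le> i \<and> i < n \<and> inv u (i + 1) < inv u i"
proof (rule ccontr)
  assume no: "\<not> ?thesis"
  have iu: "inv u permutes {1..n}" using u by (rule permutes_inv)
  have "inv u i < inv u (i + 1)" if "1 \<le> i" "i < n" for i
  proof -
    have "\<not> inv u (i + 1) < inv u i" using no that by blast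
    moreover have "inv u i \<noteq> inv u (i + 1)" by (simp add: inj_eq[OF permutes_inj[OF iu]])
    ultimately show ?thesis by linarith
  qed
  then have "inv u = id" by (rule increasing_permutes_eq_id[OF iu])
  then show False using assms inv_inv_eq[OF permutes_bij[OF u]] by (metis inv_id)
qed

definition inversions :: "nat \<Rightarrow> (nat \<Rightarrow> nat) \<Rightarrow> (nat \<times> nat) set"
  where "inversions n v = {(a, b) \<in> pos_roots n. v b < v a}"

lemma finite_pos_roots [simp]: "finite (pos_roots n)"
  by (rule finite_subset[of _ "{1..n} \<times> {1..n}"]) (auto simp: pos_roots_def)

lemma root_act_sign:
  assumes "v permutes {1..n}" "\<alpha> \<in> pos_roots n"
  shows "root_act v \<alpha> \<in> neg_roots n \<longleftrightarrow> \<alpha> \<in> inversions n v"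
        "root_act v \<alpha> \<in> pos_roots n \<longleftrightarrow> \<alpha> \<notin> inversions n v"
proof -
  obtain a b where \<alpha>: "\<alpha> = (a, b)" "1 \<le> a" "a < b" "b \<le> n" using assms(2) by (auto simp: pos_roots_def)
  have "v a \<in> {1..n}" "v b \<in> {1..n}" using \<alpha> permutes_in_image[OF assms(1)] by auto
  moreover have "v a \<noteq> v b" using \<alpha> by (simp add: inj_eq[OF permutes_inj[OF assms(1)]])
  ultimately show "root_act v \<alpha> \<in> neg_roots n \<longleftrightarrow> \<alpha> \<in> inversions n v"
        "root_act v \<alpha> \<in> pos_roots n \<longleftrightarrow> \<alpha> \<notin> inversions n v"
    using \<alpha> by (auto simp: inversions_def root_act_def neg_roots_def neg_root_def pos_roots_def image_iff)
qed

lemma perm_length_eq: "v permutes {1..n} \<Longrightarrow> perm_length n v = card (inversions n v)"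
  unfolding perm_length_def by (rule arg_cong[where f = card]) (auto simp: root_act_sign inversions_def)

lemma simple_refl_permutes: "1 \<le> i \<Longrightarrow> i < n \<Longrightarrow> simple_refl i permutes {1..n}"
  unfolding simple_refl_def by (rule permutes_swap_id) auto

lemma simple_refl_comp_permutes:
  "v permutes {1..n} \<Longrightarrow> 1 \<le> i \<Longrightarrow> i < n \<Longrightarrow> simple_refl i \<circ> v permutes {1..n}"
  by (rule permutes_compose[OF _ simple_refl_permutes])

lemma inv_simple_refl_comp: "v permutes {1..n} \<Longrightarrow> inv (simple_refl i \<circ> v) = inv v \<circ> simple_refl i"
  unfolding simple_refl_def by (subst o_inv_distrib) (auto simp: permutes_bij)

lemma simple_refl_cancel [simp]: "simple_refl i \<circ> (simple_refl i \<circ> v) = v"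
  by (simp add: simple_refl_def flip: comp_assoc)

text \<open>
  Composing with \<open>s\<^sub>i\<close> on the left changes the relative order of two values only if these are
  \<open>i\<close> and \<open>i + 1\<close>, so exactly one pair of positions becomes an inversion.
\<close>

lemma inversions_ascent:
  assumes v: "v permutes {1..n}" and i: "1 \<le> i" "i < n" and asc: "inv v i < inv v (i + 1)"
  shows "inversions n (simple_refl i \<circ> v) = insert (inv v i, inv v (i + 1)) (inversions n v)"
    "(inv v i, inv v (i + 1)) \<in> pos_roots n" "(inv v i, inv v (i + 1)) \<notin> inversions n v"
proof -
  have vv: "v (inv v j) = j" "inv v (v j) = j" for j using permutes_inverses[OF v] by auto
  have "inv v i \<in> {1..n}" "inv v (i + 1) \<in> {1..n}" using i permutes_in_image[OF permutes_inv[OF v]] by auto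
  then show pos: "(inv v i, inv v (i + 1)) \<in> pos_roots n" using asc by (auto simp: pos_roots_def)
  show "(inv v i, inv v (i + 1)) \<notin> inversions n v" by (simp add: inversions_def vv del: Suc_eq_plus1 add_Suc_right)
  have "simple_refl i (v b) < simple_refl i (v a) \<longleftrightarrow> (a, b) = (inv v i, inv v (i + 1)) \<or> v b < v a"
    if ab: "(a, b) \<in> pos_roots n" for a b
  proof (cases "v a = i + 1 \<and> v b = i")
    case True
    then have "a = inv v (i + 1)" "b = inv v i" by (metis vv(2))+
    then show ?thesis using asc ab by (simp add: pos_roots_def)
  next
    case False
    have "(a, b) = (inv v i, inv v (i + 1)) \<longleftrightarrow> v a = i \<and> v b = i + 1" by (metis Pair_inject vv)
    moreover have "v a \<noteq> v b" using ab by (auto simp: pos_roots_def inj_eq[OF permutes_inj[OF v]])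
    ultimately show ?thesis using False by (auto simp: simple_refl_def transpose_def)
  qed
  then show "inversions n (simple_refl i \<circ> v) = insert (inv v i, inv v (i + 1)) (inversions n v)"
    using pos unfolding inversions_def by auto
qed

lemma perm_length_ascent:
  assumes v: "v permutes {1..n}" and i: "1 \<le> i" "i < n" and asc: "inv v i < inv v (i + 1)"
  shows "perm_length n (simple_refl i \<circ> v) = perm_length n v + 1"
proof -
  have "finite (inversions n v)" by (rule finite_subset[of _ "pos_roots n"]) (auto simp: inversions_def)
  then show ?thesis
    unfolding perm_length_eq[OF v] perm_length_eq[OF simple_refl_comp_permutes[OF v i]] inversions_ascent(1)[OF assms]
    using inversions_ascent(3)[OF assms] by simp
qed

lemma inv_simple_refl_comp_at:
  assumes "v permutes {1..n}"
  shows "inv (simple_refl i \<circ> v) i = inv v (i + 1)" "inv (simple_refl i \<circ> v) (i + 1) = inv v i"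
  unfolding inv_simple_refl_comp[OF assms] by (simp_all add: simple_refl_def)

lemma perm_length_simple_refl_le:
  assumes v: "v permutes {1..n}" and i: "1 \<le> i" "i < n"
  shows "perm_length n (simple_refl i \<circ> v) \<le> perm_length n v + 1"
proof (cases "inv v i < inv v (i + 1)")
  case False
  moreover have "inv v i \<noteq> inv v (i + 1)" by (simp add: inj_eq[OF permutes_inj[OF permutes_inv[OF v]]])
  ultimately have "inv (simple_refl i \<circ> v) i < inv (simple_refl i \<circ> v) (i + 1)"
    using inv_simple_refl_comp_at[OF v] by simp
  from perm_length_ascent[OF simple_refl_comp_permutes[OF v i] i this] show ?thesis by simp
qed (simp add: perm_length_ascent[OF assms])

text \<open>
  Interchanging the values \<open>i\<close> and \<open>i + 1\<close> is the same as interchanging the positions at which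
  they occur, which is the form in which Bruhat steps are defined.
\<close>

lemma bruhat_less_ascent:
  assumes v: "v permutes {1..n}" and i: "1 \<le> i" "i < n" and asc: "inv v i < inv v (i + 1)"
  shows "bruhat_less n v (simple_refl i \<circ> v)"
proof -
  have len: "perm_length n v < perm_length n (simple_refl i \<circ> v)" using perm_length_ascent[OF assms] by simp
  have "simple_refl i \<circ> v = v \<circ> transpose (inv v i) (inv v (i + 1))"
  proof
    fix j
    have vj: "v j = i \<longleftrightarrow> j = inv v i" "v j = i + 1 \<longleftrightarrow> j = inv v (i + 1)"
      using permutes_inverses[OF v] by metis+
    show "(simple_refl i \<circ> v) j = (v \<circ> transpose (inv v i) (inv v (i + 1))) j"
      using vj asc permutes_inverses[OF v] by (auto simp: simple_refl_def transpose_def)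
  qed
  then have "bruhat_step n v (simple_refl i \<circ> v)"
    using v len inversions_ascent(2)[OF assms] unfolding bruhat_step_def pos_roots_def by auto
  then show ?thesis using len unfolding bruhat_less_def bruhat_le_def by auto
qed

lemma bruhat_le_imp: "bruhat_le n u v \<Longrightarrow> u = v \<or> perm_length n u < perm_length n v"
  unfolding bruhat_le_def
proof (induction rule: rtranclp_induct)
  case (step w w')
  from step(2) have "perm_length n w < perm_length n w'" by (simp add: bruhat_step_def)
  with step.IH show ?case by auto
qed simp

lemma inversions_id: "inversions n id = {}"
  by (auto simp: inversions_def pos_roots_def)

lemma perm_length_le: "perm_length n u \<le> card (pos_roots n)"
  unfolding perm_length_def by (intro card_mono) auto

section \<open>The factor phi\<close>

text \<open>
  Both products in \<open>\<phi>\<close> become one product over all positive roots, so that two values of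
  \<open>\<phi>\<close> can be compared factor by factor.
\<close>

lemma phi_inv_eq:
  assumes v: "v permutes {1..n}"
  shows "phi n q y (inv v) = (\<Prod>\<alpha>\<in>pos_roots n. if \<alpha> \<in> inversions n v
     then 1 - y (snd \<alpha>) / y (fst \<alpha>) else q * (y (snd \<alpha>) / y (fst \<alpha>)) - 1)"
proof -
  have "{\<alpha> \<in> pos_roots n. root_act (inv (inv v)) \<alpha> \<in> pos_roots n} = pos_roots n \<inter> - inversions n v"
     "{\<alpha> \<in> pos_roots n. root_act (inv (inv v)) \<alpha> \<in> neg_roots n} = pos_roots n \<inter> inversions n v"
    using root_act_sign[OF v] by (auto simp: inv_inv_eq permutes_bij[OF v])
  then show ?thesis
    by (simp add: phi_def prod.If_cases yexp_def neg_root_def mult.commute)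
qed

text \<open>
  Only the factor of the one pair of positions that becomes an inversion changes.
\<close>

lemma phi_ascent:
  assumes v: "v permutes {1..n}" and i: "1 \<le> i" "i < n" and asc: "inv v i < inv v (i + 1)"
    and X: "X = y (inv v i)" "X' = y (inv v (i + 1))" "X \<noteq> 0"
  shows "(q * X' - X) * phi n q y (inv (simple_refl i \<circ> v)) = (X - X') * phi n q y (inv v)"
proof -
  let ?\<beta> = "(inv v i, inv v (i + 1))"
  define R where "R = (\<Prod>\<alpha>\<in>pos_roots n - {?\<beta>}. if \<alpha> \<in> inversions n v
     then 1 - y (snd \<alpha>) / y (fst \<alpha>) else q * (y (snd \<alpha>) / y (fst \<alpha>)) - 1)"
  note asc' = inversions_ascent[OF v i asc]
  have "phi n q y (inv (simple_refl i \<circ> v)) = (1 - X' / X) * R"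
    unfolding phi_inv_eq[OF simple_refl_comp_permutes[OF v i]] R_def
    by (subst prod.remove[OF finite_pos_roots asc'(2)]) (auto simp: asc'(1) X intro!: prod.cong)
  moreover have "phi n q y (inv v) = (q * (X' / X) - 1) * R"
    unfolding phi_inv_eq[OF v] R_def
    by (subst prod.remove[OF finite_pos_roots asc'(2)]) (use asc'(3) in \<open>auto simp: X\<close>)
  ultimately have 1: "X * phi n q y (inv (simple_refl i \<circ> v)) = (X - X') * R" and 2: "X * phi n q y (inv v) = (q * X' - X) * R"
    using X(3) by (simp_all add: field_simps)
  have "X * ((q * X' - X) * phi n q y (inv (simple_refl i \<circ> v))) = (q * X' - X) * ((X - X') * R)"
    unfolding 1[symmetric] by (rule mult.left_commute)
  also have "\<dots> = X * ((X - X') * phi n q y (inv v))"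
    unfolding mult.left_commute[of X] 2 by (rule mult.left_commute)
  finally show ?thesis using X(3) by simp
qed

lemma phi_nonzero:
  assumes v: "v permutes {1..n}"
    and y: "\<And>i. i \<in> {1..n} \<Longrightarrow> y i \<noteq> 0" "\<And>i j. i \<in> {1..n} \<Longrightarrow> j \<in> {1..n} \<Longrightarrow> i \<noteq> j \<Longrightarrow> y i \<noteq> y j \<and> q * y i \<noteq> y j"
  shows "phi n q y (inv v) \<noteq> 0"
proof -
  have "(if \<alpha> \<in> inversions n v then 1 - y (snd \<alpha>) / y (fst \<alpha>) else q * (y (snd \<alpha>) / y (fst \<alpha>)) - 1) \<noteq> 0"
    if "\<alpha> \<in> pos_roots n" for \<alpha>
    using that y(1)[of "fst \<alpha>"] y(2)[of "snd \<alpha>" "fst \<alpha>"] by (auto simp: pos_roots_def)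
  then show ?thesis unfolding phi_inv_eq[OF v] by (subst prod_zero_iff) auto
qed

section \<open>The state with decreasing colours on the right boundary\<close>

text \<open>
  Row by row from the top: if the column \<open>j\<close> still carries just its own colour \<open>j\<close> for
  \<open>j \<le> n + 1 - i\<close> and is empty otherwise, then row \<open>i\<close>, which must end in the colour
  \<open>c = n + 1 - i\<close> on the right, can have picked it up only in column \<open>c\<close>.  To the right of that
  column no other source of \<open>c\<close> exists, and to the left of it nothing but empty vertical edges is
  met.
\<close>

lemma forced_state:
  assumes st: "(h, V) \<in> states n id (rev_perm n)"
    and nz: "\<And>i j. i \<in> {1..n} \<Longrightarrow> j \<in> {1..n} \<Longrightarrow> weight_at t (z i j) (h (i, j)) (V (i - 1, j)) (h (i, j - 1)) (V (i, j)) \<noteq> 0"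
  shows "h = (\<lambda>(i, j)\<in>{1..n} \<times> {0..n}. if i + j \<le> n then Some (n + 1 - i) else None)"
    "V = (\<lambda>(i, j)\<in>{0..n} \<times> {1..n}. if i + j \<le> n then {j} else {})"
proof -
  have h: "h \<in> ({1..n} \<times> {0..n}) \<rightarrow>\<^sub>E ({None} \<union> Some ` {1..n})" and V: "V \<in> ({0..n} \<times> {1..n}) \<rightarrow>\<^sub>E Pow {1..n}"
    and top: "\<And>j. j \<in> {1..n} \<Longrightarrow> V (0, j) = {j}" and right: "\<And>i. i \<in> {1..n} \<Longrightarrow> h (i, 0) = Some (n + 1 - i)"
    and left: "\<And>i. i \<in> {1..n} \<Longrightarrow> h (i, n) = None"
    using st by (auto simp: states_def rev_perm_def)
  have row: "(\<forall>j\<le>n. h (i, j) = (if i + j \<le> n then Some (n + 1 - i) else None)) \<and>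
       (\<forall>j\<in>{1..n}. V (i, j) = (if i + j \<le> n then {j} else {}))"
    if i: "i \<in> {1..n}" and above: "\<And>j. j \<in> {1..n} \<Longrightarrow> V (i - 1, j) = (if i - 1 + j \<le> n then {j} else {})" for i
  proof -
    define c where "c = n + 1 - i"
    have c: "1 \<le> c" "c \<le> n" "i + c = n + 1" using i by (auto simp: c_def)
    have colored: "j < c \<longrightarrow> h (i, j) = Some c" for j
    proof (induction j)
      case (Suc j)
      show ?case
      proof
        assume j: "Suc j < c"
        then have "h (i, j) = Some c" "V (i - 1, Suc j) = {Suc j}" using Suc c i above[of "Suc j"] by auto
        then show "h (i, Suc j) = Some c"
          using nz[OF i, of "Suc j"] j c by (cases "h (i, Suc j)") (auto split: if_splits)
      qed
    qed (use right[OF i] c in \<open>auto simp: c_def\<close>)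
    have uncolored: "h (i, j) = None" if "c \<le> j" "j \<le> n" for j
      using that(2,1)
    proof (induction j rule: inc_induct)
      case (step j)
      then have "h (i, Suc j) = None" "V (i - 1, Suc j) = {}" using above[of "Suc j"] c i by auto
      then show ?case using nz[OF i, of "Suc j"] step c by (cases "h (i, j)") auto
    qed (use left[OF i] in auto)
    have below: "V (i, j) = (if j < c then {j} else {})" if j: "j \<in> {1..n}" for j
    proof -
      consider "j < c" | "j = c" | "c < j" by linarith
      then show ?thesis
      proof cases
        case 1
        then have "h (i, j) = Some c" "h (i, j - 1) = Some c" "V (i - 1, j) = {j}"
          using colored above[OF j] c i by auto
        then show ?thesis using nz[OF i j] 1 by (auto split: if_splits)
      next
        case 2
        then have "h (i, j) = None" "h (i, j - 1) = Some c" "V (i - 1, j) = {j}"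
          using colored uncolored above[OF j] c i by auto
        then show ?thesis using nz[OF i j] 2 by (auto split: if_splits)
      next
        case 3
        then have "h (i, j) = None" "h (i, j - 1) = None" "V (i - 1, j) = {}"
          using uncolored above[OF j] c i j by auto
        then show ?thesis using nz[OF i j] 3 by (auto split: if_splits)
      qed
    qed
    show ?thesis using colored uncolored below c by (auto simp: c_def)
  qed
  have vert: "\<forall>j\<in>{1..n}. V (i, j) = (if i + j \<le> n then {j} else {})" if "i \<le> n" for i
    using that
  proof (induction i)
    case (Suc i)
    then show ?case using row[of "Suc i"] by auto
  qed (use top in auto)
  show "h = (\<lambda>(i, j)\<in>{1..n} \<times> {0..n}. if i + j \<le> n then Some (n + 1 - i) else None)"
  proof (rule extensionalityI[of _ "{1..n} \<times> {0..n}"])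
    fix e assume "e \<in> {1..n} \<times> {0..n}"
    then obtain i j where e: "e = (i, j)" "i \<in> {1..n}" "j \<le> n" by auto
    have "h (i, j) = (if i + j \<le> n then Some (n + 1 - i) else None)"
      using row[OF e(2)] vert[of "i - 1"] e by auto
    then show "h e = (\<lambda>(i, j)\<in>{1..n} \<times> {0..n}. if i + j \<le> n then Some (n + 1 - i) else None) e"
      using e by auto
  qed (use h in \<open>auto simp: PiE_def\<close>)
  show "V = (\<lambda>(i, j)\<in>{0..n} \<times> {1..n}. if i + j \<le> n then {j} else {})"
    by (rule extensionalityI[of _ "{0..n} \<times> {1..n}"]) (use V vert in \<open>auto simp: PiE_def\<close>)
qed

lemma Z_square_rev_perm:
  "Z_square n t id (rev_perm n) x y = (\<Prod>i\<in>{1..n}. \<Prod>j\<in>{1..n}. if i + j \<le> n then 1 - x i * inverse (y j) else 1)"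
proof -
  define h where "h = (\<lambda>(i, j)\<in>{1..n} \<times> {0..n}. if i + j \<le> n then Some (n + 1 - i) else None)"
  define V where "V = (\<lambda>(i, j)\<in>{0..n} \<times> {1..n}. if i + j \<le> n then {j} else {})"
  have color: "Some (Suc n - i) \<in> Some ` {Suc 0..n}" if "Suc 0 \<le> i" "i \<le> n" for i
    using that by (intro imageI) auto
  have mem: "(h, V) \<in> states n id (rev_perm n)"
    using color by (auto simp: states_def h_def V_def rev_perm_def split: if_splits)
  have fin: "finite (states n id (rev_perm n))"
    by (rule finite_subset[of _ "(({1..n} \<times> {0..n}) \<rightarrow>\<^sub>E ({None} \<union> Some ` {1..n})) \<times> (({0..n} \<times> {1..n}) \<rightarrow>\<^sub>E Pow {1..n})"])
      (auto simp: states_def intro!: finite_cartesian_product finite_PiE)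
  let ?wt = "\<lambda>h V. \<Prod>i \<in> {1..n}. \<Prod>j \<in> {1..n}. weight_at t (x i * inverse (y j)) (h (i, j)) (V (i - 1, j)) (h (i, j - 1)) (V (i, j))"
  have "Z_square n t id (rev_perm n) x y = (\<Sum>(h, V) \<in> states n id (rev_perm n). ?wt h V)"
    by (simp add: Z_square_def partition_function_def K_weight_def)
  also have "\<dots> = (\<Sum>(h, V) \<in> {(h, V)}. ?wt h V)"
  proof (rule sum.mono_neutral_right[OF fin])
    show "\<forall>e\<in>states n id (rev_perm n) - {(h, V)}. (case e of (h, V) \<Rightarrow> ?wt h V) = 0"
    proof (rule ballI, rule ccontr)
      fix e assume e: "e \<in> states n id (rev_perm n) - {(h, V)}" and nz: "(case e of (h, V) \<Rightarrow> ?wt h V) \<noteq> 0"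
      obtain h' V' where hV: "e = (h', V')" by (cases e)
      have all: "\<forall>i\<in>{1..n}. \<forall>j\<in>{1..n}. weight_at t (x i * inverse (y j)) (h' (i, j)) (V' (i - 1, j)) (h' (i, j - 1)) (V' (i, j)) \<noteq> 0"
        using nz by (simp add: hV prod_zero_iff)
      then have nz': "weight_at t (x i * inverse (y j)) (h' (i, j)) (V' (i - 1, j)) (h' (i, j - 1)) (V' (i, j)) \<noteq> 0"
        if "i \<in> {1..n}" "j \<in> {1..n}" for i j using that by blast
      have "(h', V') \<in> states n id (rev_perm n)" using e by (simp add: hV)
      from forced_state[OF this nz'] have "h' = h \<and> V' = V" unfolding h_def V_def by (rule conjI)
      then show False using e hV by auto
    qed
  qed (use mem in auto)
  also have "\<dots> = (\<Prod>i\<in>{1..n}. \<Prod>j\<in>{1..n}. if i + j \<le> n then 1 - x i * inverse (y j) else 1)"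
  proof -
    have "weight_at t (x i * inverse (y j)) (h (i, j)) (V (i - 1, j)) (h (i, j - 1)) (V (i, j))
       = (if i + j \<le> n then 1 - x i * inverse (y j) else 1)" if ij: "i \<in> {1..n}" "j \<in> {1..n}" for i j
    proof -
      consider "i + j \<le> n" | "i + j = n + 1" | "n + 1 < i + j" by linarith
      then show ?thesis
      proof cases
        case 1
        then have "h (i, j) = Some (n + 1 - i)" "h (i, j - 1) = Some (n + 1 - i)" "V (i - 1, j) = {j}" "V (i, j) = {j}"
          using ij by (auto simp: h_def V_def)
        moreover have "n + 1 - i \<noteq> j" using 1 by auto
        ultimately show ?thesis using 1 by (simp add: Collect_conv_if)
      next
        case 2
        then have "h (i, j) = None" "h (i, j - 1) = Some j" "V (i - 1, j) = {j}" "V (i, j) = {}"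
          using ij by (auto simp: h_def V_def)
        then show ?thesis using 2 by (simp add: Collect_conv_if)
      next
        case 3
        then have "h (i, j) = None" "h (i, j - 1) = None" "V (i - 1, j) = {}" "V (i, j) = {}"
          using ij by (auto simp: h_def V_def)
        then show ?thesis using 3 by simp
      qed
    qed
    then show ?thesis by simp
  qed
  finally show ?thesis .
qed

section \<open>Recursion for the specialised partition functions\<close>

definition zeta :: "nat \<Rightarrow> 'a::field \<Rightarrow> (nat \<Rightarrow> 'a) \<Rightarrow> (nat \<Rightarrow> nat) \<Rightarrow> (nat \<Rightarrow> nat) \<Rightarrow> 'a"
  where "zeta n q y u v = specialize (Z_square n q id (inv u)) (inv v) y"

lemma zeta_exchange:
  assumes u: "u permutes {1..n}" and v: "v permutes {1..n}" and i: "1 \<le> i" "i < n"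
    and y: "\<And>j. j \<in> {1..n} \<Longrightarrow> y j \<noteq> 0"
    and X: "X = y (inv v i)" "X' = y (inv v (i + 1))"
  shows "(X' - q * X) * zeta n q y u v =
     (if inv u i < inv u (i + 1)
      then (1 - q) * X' * zeta n q y u (simple_refl i \<circ> v) + q * (X - X') * zeta n q y (simple_refl i \<circ> u) (simple_refl i \<circ> v)
      else (1 - q) * X * zeta n q y u (simple_refl i \<circ> v) + (X - X') * zeta n q y (simple_refl i \<circ> u) (simple_refl i \<circ> v))"
proof -
  have "inv u i \<noteq> inv u (i + 1)" by (simp add: inj_eq[OF permutes_inj[OF permutes_inv[OF u]]])
  moreover have "inv u j \<in> {1..n}" if "j \<in> {1..n}" for j
    using that permutes_in_image[OF permutes_inv[OF u]] by blast
  moreover have "(\<lambda>i. y (inv v i)) \<circ> simple_refl i = (\<lambda>j. y (inv (simple_refl i \<circ> v) j))"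
    by (simp add: inv_simple_refl_comp[OF v] fun_eq_iff)
  ultimately show ?thesis
    using Z_square_exchange[of n id "inv u" i y "\<lambda>i. y (inv v i)" q] i y
    by (simp add: zeta_def specialize_def X inv_simple_refl_comp[OF u] flip: simple_refl_def[unfolded Suc_eq_plus1[symmetric]])
qed

text \<open>
  If \<open>v\<close> is not \<open>w\<^sub>0\<close>, then \<open>v\<^sup>-\<^sup>1(i) < n + 1 - i\<close> for some \<open>i\<close>, and the factor
  at row \<open>i\<close> and column \<open>j = v\<^sup>-\<^sup>1(i)\<close> is \<open>1 - y\<^sub>j / y\<^sub>j = 0\<close>.  If \<open>v\<close> is
  \<open>w\<^sub>0\<close>, every positive root is an inversion and the factors match those of \<open>\<phi>\<close>.
\<close>

lemma zeta_rev_perm: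
  assumes v: "v permutes {1..n}" and y: "\<And>j. j \<in> {1..n} \<Longrightarrow> y j \<noteq> 0"
  shows "v \<noteq> rev_perm n \<Longrightarrow> zeta n q y (rev_perm n) v = 0"
    "zeta n q y (rev_perm n) (rev_perm n) = phi n q y (inv (rev_perm n))"
proof -
  have Z: "zeta n q y (rev_perm n) v' = (\<Prod>i\<in>{1..n}. \<Prod>j\<in>{1..n}. if i + j \<le> n then 1 - y (inv v' i) * inverse (y j) else 1)" for v'
    by (simp add: zeta_def specialize_def inv_rev_perm Z_square_rev_perm)
  show "zeta n q y (rev_perm n) v = 0" if "v \<noteq> rev_perm n"
  proof -
    have iv: "inv v permutes {1..n}" using v by (rule permutes_inv)
    have "\<exists>i\<in>{1..n}. inv v i < rev_perm n i"
    proof (rule ccontr)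
      assume "\<not> ?thesis"
      then have "rev_perm n = inv v" by (intro permutes_eq_if_le[OF rev_perm_permutes iv]) force
      then have "v = rev_perm n" using inv_rev_perm inv_inv_eq[OF permutes_bij[OF v]] by metis
      with that show False by simp
    qed
    then obtain i where i: "i \<in> {1..n}" "inv v i < rev_perm n i" by blast
    have j: "inv v i \<in> {1..n}" using i permutes_in_image[OF iv] by blast
    have "(if i + inv v i \<le> n then 1 - y (inv v i) * inverse (y (inv v i)) else 1) = 0"
      using i y[OF j] by (simp add: rev_perm_def)
    then have "(\<Prod>j\<in>{1..n}. if i + j \<le> n then 1 - y (inv v i) * inverse (y j) else 1) = 0"
      using j by (intro prod_zero bexI[of _ "inv v i"]) auto
    then have "\<exists>i\<in>{1..n}. (\<Prod>j\<in>{1..n}. if i + j \<le> n then 1 - y (inv v i) * inverse (y j) else 1) = 0"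
      using i(1) by (rule bexI)
    then show ?thesis unfolding Z by (rule prod_zero[OF finite_atLeastAtMost])
  qed
  have inv_all: "inversions n (rev_perm n) = pos_roots n"
    by (auto simp: inversions_def pos_roots_def rev_perm_def)
  have "zeta n q y (rev_perm n) (rev_perm n)
     = (\<Prod>(i, j)\<in>{1..n} \<times> {1..n}. if i + j \<le> n then 1 - y (rev_perm n i) * inverse (y j) else 1)"
    unfolding Z inv_rev_perm by (rule prod.cartesian_product)
  also have "\<dots> = (\<Prod>(i, j)\<in>{(i, j) \<in> {1..n} \<times> {1..n}. i + j \<le> n}. 1 - y (rev_perm n i) * inverse (y j))"
    by (rule prod.mono_neutral_cong_right) (auto split: if_splits)
  also have "\<dots> = (\<Prod>\<alpha>\<in>pos_roots n. 1 - y (snd \<alpha>) / y (fst \<alpha>))"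
    by (rule prod.reindex_bij_witness[where j = "\<lambda>(i, j). (j, rev_perm n i)" and i = "\<lambda>(a, b). (rev_perm n b, a)"])
      (auto simp: pos_roots_def rev_perm_def divide_inverse)
  finally show "zeta n q y (rev_perm n) (rev_perm n) = phi n q y (inv (rev_perm n))"
    unfolding phi_inv_eq[OF rev_perm_permutes] inv_all by simp
qed

text \<open>
  The conditions under which none of the denominators in the recursion and no value of \<open>\<phi>\<close>
  vanishes.
\<close>

locale distinct_parameters =
  fixes n :: nat and q :: "'a::field" and y :: "nat \<Rightarrow> 'a"
  assumes y_nonzero: "\<And>i. i \<in> {1..n} \<Longrightarrow> y i \<noteq> 0"
    and y_distinct: "\<And>i j. i \<in> {1..n} \<Longrightarrow> j \<in> {1..n} \<Longrightarrow> i \<noteq> j \<Longrightarrow> y i \<noteq> y j"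
    and qy_distinct: "\<And>i j. i \<in> {1..n} \<Longrightarrow> j \<in> {1..n} \<Longrightarrow> i \<noteq> j \<Longrightarrow> q * y i \<noteq> y j"
begin

lemma row_parameters:
  assumes v: "v permutes {1..n}" and i: "1 \<le> i" "i < n"
  shows "y (inv v i) \<noteq> 0" "y (inv v (i + 1)) \<noteq> 0" "y (inv v i) \<noteq> y (inv v (i + 1))"
    "y (inv v (i + 1)) \<noteq> q * y (inv v i)"
proof -
  have "inv v i \<in> {1..n}" "inv v (i + 1) \<in> {1..n}" using i permutes_in_image[OF permutes_inv[OF v]] by auto
  moreover have "inv v i \<noteq> inv v (i + 1)" by (simp add: inj_eq[OF permutes_inj[OF permutes_inv[OF v]]])
  ultimately show "y (inv v i) \<noteq> 0" "y (inv v (i + 1)) \<noteq> 0" "y (inv v i) \<noteq> y (inv v (i + 1))"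
    "y (inv v (i + 1)) \<noteq> q * y (inv v i)"
    using y_nonzero y_distinct qy_distinct by metis+
qed

text \<open>
  Induction from the longest element downwards.  For an ascent \<open>i\<close> of \<open>u\<close> put
  \<open>u' = s\<^sub>i u\<close>.  The exchange relation at \<open>(u', s\<^sub>i v)\<close> expresses \<open>\<zeta>(u, v)\<close> through
  \<open>\<zeta>(u', v)\<close> and \<open>\<zeta>(u', s\<^sub>i v)\<close>; since \<open>u'\<close> is longer than \<open>u\<close> by one and
  \<open>s\<^sub>i v\<close> is longer than \<open>v\<close> by at most one, the vanishing is inherited.  For \<open>v = u\<close> one
  of the two terms drops out and the diagonal value is that of \<open>u'\<close> up to the ratio found in
  \<open>phi_ascent\<close>.
\<close>

lemma zeta_triangular:
  assumes "u permutes {1..n}"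
  shows "(\<forall>v. v permutes {1..n} \<longrightarrow> zeta n q y u v \<noteq> 0 \<longrightarrow> u = v \<or> perm_length n u < perm_length n v) \<and>
     zeta n q y u u = phi n q y (inv u)"
  using assms
proof (induction "card (pos_roots n) - perm_length n u" arbitrary: u rule: less_induct)
  case less
  show ?case
  proof (cases "u = rev_perm n")
    case True
    then show ?thesis using zeta_rev_perm y_nonzero rev_perm_permutes by metis
  next
    case False
    then obtain i where i: "1 \<le> i" "i < n" and asc: "inv u i < inv u (i + 1)"
      using exists_ascent[OF less.prems] by metis
    let ?s = "simple_refl i" and ?\<zeta> = "zeta n q y"
    define u' where "u' = ?s \<circ> u"
    have u': "u' permutes {1..n}" unfolding u'_def by (rule simple_refl_comp_permutes[OF less.prems i])
    have su': "?s \<circ> u' = u" by (simp add: u'_def)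
    have len: "perm_length n u' = perm_length n u + 1"
      unfolding u'_def by (rule perm_length_ascent[OF less.prems i asc])
    have desc: "\<not> inv u' i < inv u' (i + 1)"
      using asc inv_simple_refl_comp_at[OF less.prems, of i] by (simp add: u'_def)
    have "card (pos_roots n) - perm_length n u' < card (pos_roots n) - perm_length n u"
      using len perm_length_le[of n u'] by linarith
    note IH = less.hyps[OF this u']
    have step: "(y (inv v i) - q * y (inv v (i + 1))) * ?\<zeta> u' (?s \<circ> v) =
        (1 - q) * y (inv v (i + 1)) * ?\<zeta> u' v + (y (inv v (i + 1)) - y (inv v i)) * ?\<zeta> u v"
      if v: "v permutes {1..n}" for v
      using zeta_exchange[OF u' simple_refl_comp_permutes[OF v i] i y_nonzero refl refl, where q = q] desc
      by (simp add: inv_simple_refl_comp_at[OF v, simplified] su')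
    have "u = v \<or> perm_length n u < perm_length n v" if v: "v permutes {1..n}" and nz: "?\<zeta> u v \<noteq> 0" for v
    proof -
      have "?\<zeta> u' (?s \<circ> v) \<noteq> 0 \<or> ?\<zeta> u' v \<noteq> 0"
        using step[OF v] nz row_parameters(3)[OF v i] by auto
      then have "u' = ?s \<circ> v \<or> perm_length n u' < perm_length n (?s \<circ> v) \<or> u' = v \<or> perm_length n u' < perm_length n v"
        using IH v simple_refl_comp_permutes[OF v i] by blast
      moreover have "u = v" if "u' = ?s \<circ> v" using that su' by simp
      ultimately show ?thesis using len perm_length_simple_refl_le[OF v i] by auto
    qed
    moreover have "?\<zeta> u u = phi n q y (inv u)"
    proof -
      have "?\<zeta> u' u = 0" using IH less.prems len by force
      then have "(y (inv u i) - q * y (inv u (i + 1))) * phi n q y (inv u') = (y (inv u (i + 1)) - y (inv u i)) * ?\<zeta> u u"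
        using step[OF less.prems] IH by (simp add: u'_def)
      moreover have "(q * y (inv u (i + 1)) - y (inv u i)) * phi n q y (inv u') = (y (inv u i) - y (inv u (i + 1))) * phi n q y (inv u)"
        unfolding u'_def using phi_ascent[OF less.prems i asc refl refl] row_parameters(1)[OF less.prems i] by blast
      ultimately have "(y (inv u (i + 1)) - y (inv u i)) * ?\<zeta> u u = (y (inv u (i + 1)) - y (inv u i)) * phi n q y (inv u)"
        by algebra
      then show ?thesis using row_parameters(3)[OF less.prems i] by simp
    qed
    ultimately show ?thesis by blast
  qed
qed

text \<open>
  Induction on the length of \<open>v\<close>.  With \<open>X = y (inv v i)\<close> and \<open>X'\<close> likewise for
  \<open>i + 1\<close>, the root in the recursion satisfies \<open>y\<^sup>\<beta> = X' / X\<close>; multiplied by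
  \<open>X - X'\<close> the recursion acquires the coefficients of the R-matrix, and \<open>phi_ascent\<close> turns
  the factor \<open>X - X'\<close> into \<open>X' - q X\<close>.
\<close>

lemma bump_nakasuji_eq_zeta:
  assumes r: "bump_nakasuji_family n q y r" and "u permutes {1..n}" "v permutes {1..n}"
  shows "r u v * phi n q y (inv v) = zeta n q y u v"
  using assms(2,3)
proof (induction "perm_length n v" arbitrary: u v rule: less_induct)
  case less
  have r_zero: "r u v = 0" if "u permutes {1..n}" "v permutes {1..n}" "\<not> bruhat_le n u v" for u v
    using r that by (simp add: bump_nakasuji_family_def)
  have r_one: "r v v = 1" if "v permutes {1..n}" for v
    using r that by (simp add: bump_nakasuji_family_def)
  show ?case
  proof (cases "v = id")
    case True
    have len: "perm_length n (id :: nat \<Rightarrow> nat) = 0"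
      unfolding perm_length_eq[OF permutes_id] by (simp add: inversions_id)
    show ?thesis
    proof (cases "u = id")
      case True
      then show ?thesis using \<open>v = id\<close> zeta_triangular[OF less.prems(1)] r_one[OF less.prems(1)] by simp
    next
      case False
      then have "\<not> bruhat_le n u id" using bruhat_le_imp len by fastforce
      moreover have "zeta n q y u id = 0"
        using zeta_triangular[OF less.prems(1)] permutes_id len False by fastforce
      ultimately show ?thesis using r_zero[OF less.prems] \<open>v = id\<close> by simp
    qed
  next
    case False
    then obtain i where i: "1 \<le> i" "i < n" and desc: "inv v (i + 1) < inv v i"
      using exists_descent[OF less.prems(2)] by metis
    let ?s = "simple_refl i" and ?\<zeta> = "zeta n q y"
    define v' where "v' = ?s \<circ> v"
    have v': "v' permutes {1..n}" unfolding v'_def by (rule simple_refl_comp_permutes[OF less.prems(2) i])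
    have sv': "?s \<circ> v' = v" by (simp add: v'_def)
    have v'_at: "inv v' i = inv v (i + 1)" "inv v' (i + 1) = inv v i"
      unfolding v'_def by (rule inv_simple_refl_comp_at[OF less.prems(2)])+
    have asc': "inv v' i < inv v' (i + 1)" using desc by (simp only: v'_at)
    have "perm_length n v' < perm_length n v" using perm_length_ascent[OF v' i asc'] by (simp add: sv')
    note IH = less.hyps[OF this _ v']
    have su: "?s \<circ> u permutes {1..n}" by (rule simple_refl_comp_permutes[OF less.prems(1) i])
    define X X' where "X = y (inv v i)" and "X' = y (inv v (i + 1))"
    have X: "X \<noteq> 0" "X' \<noteq> 0" "X \<noteq> X'" "X' - q * X \<noteq> 0"
      using row_parameters[OF less.prems(2) i] by (simp_all add: X_def X'_def)
    have nz: "y (inv v' i) \<noteq> 0" using X(2) unfolding v'_at X'_def .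
    have phi: "(q * X - X') * phi n q y (inv v) = (X' - X) * phi n q y (inv v')"
      using phi_ascent[where y = y and q = q, OF v' i asc' refl refl nz] by (simp only: v'_at sv' X_def X'_def)
    have ex: "(X' - q * X) * ?\<zeta> u v = (if inv u i < inv u (i + 1)
      then (1 - q) * X' * ?\<zeta> u v' + q * (X - X') * ?\<zeta> (?s \<circ> u) v'
      else (1 - q) * X * ?\<zeta> u v' + (X - X') * ?\<zeta> (?s \<circ> u) v')"
      unfolding v'_def by (rule zeta_exchange[OF less.prems i y_nonzero X_def X'_def])
    have less_v: "bruhat_less n v' v" using bruhat_less_ascent[OF v' i asc'] by (simp add: sv')
    have beta: "yexp y (neg_root (root_act (inv v) (simple_root i))) = X' / X"
      by (simp add: yexp_def neg_root_def root_act_def simple_root_def X_def X'_def)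
    have rec: "(bruhat_less n (?s \<circ> u) u \<longrightarrow> r u v = (1 - q) / (1 - X' / X) * r u v' + r (?s \<circ> u) v') \<and>
      (bruhat_less n u (?s \<circ> u) \<longrightarrow> r u v = (1 - q) * ((X' / X) / (1 - X' / X)) * r u v' + q * r (?s \<circ> u) v')"
      using r less.prems i less_v unfolding bump_nakasuji_family_def Let_def v'_def beta[symmetric] by blast
    have "(X - X') * r u v = (if inv u i < inv u (i + 1)
      then (1 - q) * X' * r u v' + q * (X - X') * r (?s \<circ> u) v'
      else (1 - q) * X * r u v' + (X - X') * r (?s \<circ> u) v')"
    proof (cases "inv u i < inv u (i + 1)")
      case True
      have "r u v = (1 - q) * ((X' / X) / (1 - X' / X)) * r u v' + q * r (?s \<circ> u) v'"
        using rec bruhat_less_ascent[OF less.prems(1) i True] by blast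
      moreover have "(X' / X) / (1 - X' / X) = X' / (X - X')" using X by (simp add: field_simps)
      ultimately show ?thesis using True X by (simp add: field_simps)
    next
      case False
      have "inv u i \<noteq> inv u (i + 1)" by (simp add: inj_eq[OF permutes_inj[OF permutes_inv[OF less.prems(1)]]])
      then have "inv (?s \<circ> u) i < inv (?s \<circ> u) (i + 1)"
        using False inv_simple_refl_comp_at[OF less.prems(1)] by simp
      from bruhat_less_ascent[OF su i this] have "bruhat_less n (?s \<circ> u) u" by simp
      then have "r u v = (1 - q) / (1 - X' / X) * r u v' + r (?s \<circ> u) v'" using rec by blast
      moreover have "(1 - q) / (1 - X' / X) = (1 - q) * X / (X - X')" using X by (simp add: field_simps)
      ultimately show ?thesis using False X by (simp add: field_simps)
    qed
    then have "(X - X') * r u v * phi n q y (inv v') = (X' - q * X) * ?\<zeta> u v"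
      unfolding ex IH[OF less.prems(1), symmetric] IH[OF su, symmetric] by (simp add: algebra_simps)
    moreover have "(X - X') * r u v * phi n q y (inv v') = (X' - q * X) * (r u v * phi n q y (inv v))"
      using phi by algebra
    ultimately show ?thesis using X(4) by simp
  qed
qed

end

section \<open>The field of rational functions\<close>

lemma single_one_eq_iff:
  "Poly_Mapping.single k (1 :: 'b::zero_neq_one) = Poly_Mapping.single l 1 \<longleftrightarrow> k = l"
  by (metis lookup_single_eq lookup_single_not_eq zero_neq_one)

lemma indet_eq_iff: "(indet i :: 'k::field ratfun) = indet j \<longleftrightarrow> i = j"
  by (simp add: indet_def eq_fract single_one_eq_iff del: One_nat_def)

lemma indet_nonzero: "(indet i :: 'k::field ratfun) \<noteq> 0"
proof -
  have "Poly_Mapping.single (Poly_Mapping.single i 1) (1 :: 'k) \<noteq> 0"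
    by (metis lookup_single_eq lookup_zero zero_neq_one)
  then show ?thesis by (simp add: indet_def Zero_fract_def eq_fract del: One_nat_def)
qed

text \<open>
  The two monomials have different exponents of \<open>q\<close>.
\<close>

lemma qvar_mult_yvar_neq:
  assumes "i \<noteq> 0" "j \<noteq> 0"
  shows "(qvar :: 'k::field ratfun) * yvar i \<noteq> yvar j"
proof -
  have "Poly_Mapping.lookup (Poly_Mapping.single 0 1 + Poly_Mapping.single i 1) 0 \<noteq> Poly_Mapping.lookup (Poly_Mapping.single j (1::nat)) 0"
    using assms by (simp add: lookup_add lookup_single)
  then have "Poly_Mapping.single 0 1 + Poly_Mapping.single i 1 \<noteq> Poly_Mapping.single j (1::nat)" by metis
  then show ?thesis
    by (simp add: qvar_def yvar_def indet_def eq_fract mult_single single_one_eq_iff del: One_nat_def)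
qed

theorem corollary7p12:
  fixes n :: nat and u v :: "nat \<Rightarrow> nat"
  assumes "u permutes {1..n}" and "v permutes {1..n}"
  shows
    "(\<forall>r :: (nat \<Rightarrow> nat) \<Rightarrow> (nat \<Rightarrow> nat) \<Rightarrow> 'k::field ratfun.
        bump_nakasuji_family n qvar yvar r \<longrightarrow>
        r u v = inverse (phi n qvar yvar (inv v)) *
                specialize (Z_square n qvar id (inv u)) (inv v) yvar) \<and>
     specialize (Z_square n qvar id (inv u)) (inv v) (yvar :: nat \<Rightarrow> 'k ratfun) =
       partition_function n (\<lambda>i j. weight_at qvar (yexp yvar (inv v i, j))) id (inv u)"
proof (intro conjI allI impI)
  interpret distinct_parameters n "qvar :: 'k ratfun" yvar
    by unfold_locales (auto simp: yvar_def indet_eq_iff indet_nonzero qvar_mult_yvar_neq[unfolded yvar_def])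
  fix r :: "(nat \<Rightarrow> nat) \<Rightarrow> (nat \<Rightarrow> nat) \<Rightarrow> 'k ratfun"
  assume "bump_nakasuji_family n qvar yvar r"
  from bump_nakasuji_eq_zeta[OF this assms]
  have "r u v * phi n qvar yvar (inv v) = specialize (Z_square n qvar id (inv u)) (inv v) yvar"
    by (simp add: zeta_def)
  moreover have "phi n qvar yvar (inv v) \<noteq> (0 :: 'k ratfun)"
    using phi_nonzero[OF assms(2), of yvar qvar] y_nonzero y_distinct qy_distinct by metis
  ultimately show "r u v = inverse (phi n qvar yvar (inv v)) * specialize (Z_square n qvar id (inv u)) (inv v) yvar"
    by (simp add: field_simps)
next
  show "specialize (Z_square n qvar id (inv u)) (inv v) (yvar :: nat \<Rightarrow> 'k ratfun) =
       partition_function n (\<lambda>i j. weight_at qvar (yexp yvar (inv v i, j))) id (inv u)"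
    by (simp add: specialize_def Z_square_def K_weight_def yexp_def divide_inverse)
qed

end
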